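(* Assume that $g:\mathbb{R}\to(0,+\infty)$ is a non-decreasing continuous function, and that $q\ge0$, $\theta>0$, $C>0$ and $\tau\ge\theta q+1$ are constants. Then the Cauchy problem $$v'(r)=C\,r^{-q}\left(\int_0^r s^{\tau-1}g(v(s))\,ds\right)^{\frac1\theta}\quad (r\in(0,+\infty)),\qquad v(0)=a,$$ has a solution $v\in C^1[0,+\infty)\cap C^2(0,+\infty)$ with $v'(0)=0$, and $v'(r)>0$, $v''(r)>0$ for $r\in(0,+\infty)$, for any initial value $a$, if and only if $$\int^{+\infty}\left(\int_0^t g(s)\,ds\right)^{-\frac{1}{\theta+1}}dt=+\infty .$$ Moreover, the following properties hold: (i) If $\tau>\theta(q+1)$, then $v\in C^2[0,+\infty)$ with $v''(0)=0$. (ii) If $\tau=\theta(q+1)$, then $v\in C^2[0,+\infty)$ with $v''(0)=C\left(\frac{g(a)}{\tau}\right)^{\frac1\theta}$. (iii) If $\tau<\theta(q+1)$, then $v\in C^2(0,+\infty)\cap W^{2,\delta}_{loc}(0,+\infty)$, where $\delta\in\left(1,\frac{\theta}{\theta(q+1)-\tau}\right)$.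
   Context: In an integral written $\int^{+\infty}$ the lower limit is omitted; it may be any positive number. $W^{2,\delta}_{loc}$ denotes the usual local Sobolev space. *)

theory Defs
  imports "HOL-Analysis.Analysis"
begin

(* Derivative relative to S: one-sided at an endpoint of an interval that belongs to S, and
   independent of the values of f outside S. *)
definition deriv_on :: "real set \<Rightarrow> (real \<Rightarrow> real) \<Rightarrow> real \<Rightarrow> real" where
  "deriv_on S f x = vector_derivative f (at x within S)"

primrec Ck_on :: "nat \<Rightarrow> real set \<Rightarrow> (real \<Rightarrow> real) \<Rightarrow> bool" where
  "Ck_on 0 S f \<longleftrightarrow> continuous_on S f"
| "Ck_on (Suc k) S f \<longleftrightarrow> f differentiable_on S \<and> Ck_on k S (deriv_on S f)"

(* Functions are total on the reals; only their values on [0, \<infinity>) matter here.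
   For \<tau> = 1 the integrand has the value 0 powr 0 = 0 (not g (v 0)) at the single point s = 0,
   which does not affect the integral. *)
definition solves_cauchy ::
  "(real \<Rightarrow> real) \<Rightarrow> real \<Rightarrow> real \<Rightarrow> real \<Rightarrow> real \<Rightarrow> real \<Rightarrow> (real \<Rightarrow> real) \<Rightarrow> bool" where
  "solves_cauchy g q \<theta> C \<tau> a v \<longleftrightarrow>
     v 0 = a \<and>
     (\<forall>r>0. deriv_on {0..} v r =
        C * r powr (- q) * (integral {0..r} (\<lambda>s. s powr (\<tau> - 1) * g (v s))) powr (1 / \<theta>))"

definition convex_solution ::
  "(real \<Rightarrow> real) \<Rightarrow> real \<Rightarrow> real \<Rightarrow> real \<Rightarrow> real \<Rightarrow> real \<Rightarrow> (real \<Rightarrow> real) \<Rightarrow> bool" where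
  "convex_solution g q \<theta> C \<tau> a v \<longleftrightarrow>
     Ck_on 1 {0..} v \<and> Ck_on 2 {0<..} v \<and>
     solves_cauchy g q \<theta> C \<tau> a v \<and>
     deriv_on {0..} v 0 = 0 \<and>
     (\<forall>r>0. deriv_on {0..} v r > 0 \<and> deriv_on {0..} (deriv_on {0..} v) r > 0)"

definition test_function :: "real set \<Rightarrow> (real \<Rightarrow> real) \<Rightarrow> bool" where
  "test_function \<Omega> \<phi> \<longleftrightarrow>
     (\<forall>k. (deriv ^^ k) \<phi> differentiable_on UNIV) \<and>
     compact (closure {x. \<phi> x \<noteq> 0}) \<and> closure {x. \<phi> x \<noteq> 0} \<subseteq> \<Omega>"

definition Lp_on :: "real \<Rightarrow> real set \<Rightarrow> (real \<Rightarrow> real) \<Rightarrow> bool" where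
  "Lp_on p \<Omega> f \<longleftrightarrow> set_borel_measurable lebesgue \<Omega> f \<and>
     set_integrable lebesgue \<Omega> (\<lambda>x. \<bar>f x\<bar> powr p)"

(* h is the k-th weak derivative of f on \<Omega>.  The Bochner integral of a non-integrable function
   is 0, so this is meaningful only for f and h locally integrable on \<Omega>, which membership in
   Lp_on p \<Omega> with p \<ge> 1 ensures. *)
definition weak_deriv_on :: "nat \<Rightarrow> real set \<Rightarrow> (real \<Rightarrow> real) \<Rightarrow> (real \<Rightarrow> real) \<Rightarrow> bool" where
  "weak_deriv_on k \<Omega> f h \<longleftrightarrow>
     (\<forall>\<phi>. test_function \<Omega> \<phi> \<longrightarrow>
        (LINT x:\<Omega>|lebesgue. f x * (deriv ^^ k) \<phi> x) = (- 1) ^ k * (LINT x:\<Omega>|lebesgue. h x * \<phi> x))"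

definition sobolev :: "nat \<Rightarrow> real \<Rightarrow> real set \<Rightarrow> (real \<Rightarrow> real) \<Rightarrow> bool" where
  "sobolev k p \<Omega> f \<longleftrightarrow> Lp_on p \<Omega> f \<and> (\<forall>j\<in>{1..k}. \<exists>h. Lp_on p \<Omega> h \<and> weak_deriv_on j \<Omega> f h)"

definition sobolev_loc :: "nat \<Rightarrow> real \<Rightarrow> real set \<Rightarrow> (real \<Rightarrow> real) \<Rightarrow> bool" where
  "sobolev_loc k p \<Omega> f \<longleftrightarrow>
     (\<forall>U. open U \<and> compact (closure U) \<and> closure U \<subseteq> \<Omega> \<longrightarrow> sobolev k p U f)"

end

theory Submission
  imports Defs
begin

text \<open>
  Put \<open>h = g \<circ> v\<close>. The problem says that \<open>v\<close> starts at \<open>a\<close> and has derivative \<open>flux h\<close>, where \<open>h\<close> is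
  positive, continuous and non-decreasing. The integral in the flux, \<open>mass h r\<close>, then lies between
  \<open>h 0 * r powr \<tau> / \<tau>\<close> and \<open>h r * r powr \<tau> / \<tau>\<close>. The upper bound and \<open>\<tau> > \<theta> * q\<close> make the derivative of the
  flux positive (\<open>flux'_pos\<close>), so solutions are convex. Both bounds together give the limit of
  \<open>mass h r / r powr \<tau>\<close> at \<open>0\<close>: the flux behaves like a power with exponent \<open>\<tau> / \<theta> - q > 0\<close> and its
  derivative like the power with exponent \<open>\<tau> / \<theta> - q - 1\<close>. The second exponent has the sign of
  \<open>\<tau> - \<theta> * (q + 1)\<close>. If it is not negative, this gives the value of \<open>v''(0)\<close>, and if it is negative,
  the range of \<open>\<delta>\<close> for which \<open>v''\<close> has an integrable \<open>\<delta>\<close>-th power near \<open>0\<close>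
  (\<open>solution_Ck_2\<close>, \<open>solution_sobolev\<close>).

  The integral condition is the condition for an autonomous comparison equation to have no blow-up.
  Let \<open>g_primitive\<close> be the primitive of \<open>g\<close> that vanishes at \<open>0\<close>. Solutions of
  \<open>w' = c * g_primitive w powr (1 / (\<theta> + 1))\<close> satisfy \<open>(w' powr \<theta>)' = K * g w\<close>, they are obtained by
  inverting the primitive \<open>ko_integral\<close> of \<open>g_primitive powr (- 1 / (\<theta> + 1))\<close>, and they are global if and
  only if that primitive is unbounded.

  If it is unbounded, then, because \<open>\<tau> - 1 \<ge> \<theta> * q\<close>, on each interval \<open>{0..R}\<close> such a \<open>w\<close> with suitable
  \<open>K\<close> is an upper barrier (\<open>barrier_exists\<close>, \<open>flux_le_barrier\<close>). As \<open>g\<close> need not be Lipschitz, a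
  contraction argument is not available, but \<open>g\<close> is monotone: the iteration \<open>v \<mapsto> a + \<integral> flux (g \<circ> v)\<close>,
  started at the constant \<open>a\<close>, increases, remains below the barriers and converges to a solution by
  dominated convergence (\<open>convex_solution_exists\<close>).

  Conversely, the estimate behind convexity is quantitative: for every solution and \<open>r \<ge> 1\<close>,
  \<open>v' powr (\<theta> - 1) * v''\<close> is at least a constant times \<open>g v\<close> (\<open>flux'_lower_bound\<close>). Multiplying by \<open>v'\<close> and
  integrating, far out \<open>v'\<close> is at least a constant times \<open>g_primitive v powr (1 / (\<theta> + 1))\<close>. Hence \<open>ko_integral\<close>
  grows at least linearly along \<open>v\<close>, and the solution is global, so it is unbounded
  (\<open>convex_solution_imp_unbounded\<close>).
\<close>

section \<open>One-sided derivatives on half-lines\<close>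

lemma at_within_Ici_eq_Icc:
  fixes x b :: real
  assumes "x < b"
  shows "at x within {0..} = at x within {0..b}"
  by (rule at_within_nhd[of _ "{..<b}"]) (use assms in auto)

lemma at_within_Ici_neq_bot:
  fixes x :: real
  assumes "0 \<le> x"
  shows "at x within {0..} \<noteq> bot"
  using assms at_within_Ici_eq_Icc[of x "x + 1"] trivial_limit_within[of x "{0..x + 1}"]
    islimpt_Icc[of 0 "x + 1" x] by auto

lemma at_within_Ici_interior:
  fixes x :: real
  assumes "0 < x"
  shows "at x within {0..} = at x"
  by (rule at_within_interior) (use assms in simp)

lemma continuous_on_Ici_if_Icc:
  fixes f :: "real \<Rightarrow> real"
  assumes "\<And>R. R > 0 \<Longrightarrow> continuous_on {0..R} f"
  shows "continuous_on {0..} f"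
  unfolding continuous_on_def
proof
  fix x :: real assume "x \<in> {0..}"
  then show "(f \<longlongrightarrow> f x) (at x within {0..})"
    using assms[of "x + 1"] at_within_Ici_eq_Icc[of x "x + 1"]
    by (auto simp: continuous_on_def)
qed

lemma deriv_on_eqI:
  assumes "(f has_real_derivative D) (at x within S)" "at x within S \<noteq> bot"
  shows "deriv_on S f x = D"
  unfolding deriv_on_def
  using assms by (intro vector_derivative_within)
    (auto simp: has_real_derivative_iff_has_vector_derivative)

lemma has_real_derivative_deriv_on:
  assumes "f differentiable_on S" "x \<in> S" "at x within S \<noteq> bot"
  shows "(f has_real_derivative deriv_on S f x) (at x within S)"
proof -
  have "f differentiable (at x within S)"
    using assms by (auto simp: differentiable_on_def)
  then obtain D where D: "(f has_real_derivative D) (at x within S)"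
    unfolding real_differentiable_def by blast
  with deriv_on_eqI[OF D assms(3)] show ?thesis by simp
qed

lemma differentiable_onI_real:
  assumes "\<And>x. x \<in> S \<Longrightarrow> (f has_real_derivative f' x) (at x within S)"
  shows "f differentiable_on S"
  using assms unfolding differentiable_on_def real_differentiable_def by blast

lemma has_real_derivative_on_cong:
  assumes "(f has_real_derivative D) (at x within S)" "x \<in> S" "\<And>y. y \<in> S \<Longrightarrow> f y = k y"
  shows "(k has_real_derivative D) (at x within S)"
  using assms has_derivative_transform[of x S k f] unfolding has_field_derivative_def by metis

lemma Ck_on_1_eq: "Ck_on 1 S f \<longleftrightarrow> f differentiable_on S \<and> continuous_on S (deriv_on S f)"
  by (simp only: One_nat_def Ck_on.simps)

lemma Ck_on_2_eq: "Ck_on 2 S f \<longleftrightarrow> f differentiable_on S \<and> deriv_on S f differentiable_on S \<and>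
    continuous_on S (deriv_on S (deriv_on S f))"
  by (simp only: numeral_2_eq_2 Ck_on.simps)

text \<open>Explicit formulas \<open>f1\<close>, \<open>f2\<close> that hold up to the boundary of \<open>S\<close> replace the iterated
  \<open>deriv_on\<close>, so that a claim about \<open>Ck_on 2\<close> becomes one about limits at the end point.\<close>
lemma second_derivative_on:
  assumes nb: "\<And>x. x \<in> S \<Longrightarrow> at x within S \<noteq> bot"
    and f1: "\<And>x. x \<in> S \<Longrightarrow> (f has_real_derivative f1 x) (at x within S)"
    and f2: "\<And>x. x \<in> S \<Longrightarrow> (f1 has_real_derivative f2 x) (at x within S)"
    and c: "continuous_on S f2"
  shows "Ck_on 2 S f" and "\<And>x. x \<in> S \<Longrightarrow> deriv_on S (deriv_on S f) x = f2 x"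
proof -
  have d1: "deriv_on S f x = f1 x" if "x \<in> S" for x
    using deriv_on_eqI[OF f1 nb] that by auto
  have f2': "(deriv_on S f has_real_derivative f2 x) (at x within S)" if "x \<in> S" for x
    using has_real_derivative_on_cong[OF f2[OF that] that] d1 by auto
  then show d2: "deriv_on S (deriv_on S f) x = f2 x" if "x \<in> S" for x
    using deriv_on_eqI[OF _ nb] that by auto
  have "continuous_on S (deriv_on S (deriv_on S f))"
    using c d2 by (simp cong: continuous_on_cong)
  with f1 f2' show "Ck_on 2 S f"
    unfolding Ck_on_2_eq by (blast intro: differentiable_onI_real)
qed

lemma integral_has_real_derivative_Ici:
  fixes f :: "real \<Rightarrow> real"
  assumes "continuous_on {0..} f" "0 \<le> r"
  shows "((\<lambda>x. integral {0..x} f) has_real_derivative f r) (at r within {0..})"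
proof -
  have "continuous_on {0..r + 1} f"
    using assms(1) by (rule continuous_on_subset) auto
  then show ?thesis
    using integral_has_real_derivative[of 0 "r + 1" f r] assms(2) at_within_Ici_eq_Icc[of r "r + 1"]
    by auto
qed

section \<open>Weak derivatives of continuously differentiable functions\<close>

lemma deriv_nonzero_in_closure_support:
  fixes \<phi> :: "real \<Rightarrow> real"
  assumes "deriv \<phi> x \<noteq> 0"
  shows "x \<in> closure {x. \<phi> x \<noteq> 0}"
proof (rule ccontr)
  assume "x \<notin> closure {x. \<phi> x \<noteq> 0}"
  then have x: "x \<in> - closure {x. \<phi> x \<noteq> 0}" by simp
  have z: "\<phi> y = 0" if "y \<in> - closure {x. \<phi> x \<noteq> 0}" for y
    using that closure_subset[of "{x. \<phi> x \<noteq> 0}"] by blast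
  have "((\<lambda>_. 0) has_real_derivative 0) (at x)" by simp
  then have "(\<phi> has_real_derivative 0) (at x)"
    by (rule has_field_derivative_transform_within_open[where S = "- closure {x. \<phi> x \<noteq> 0}"])
      (use x z[symmetric] in \<open>blast+\<close>)
  then have "deriv \<phi> x = 0" by (rule DERIV_imp_deriv)
  with assms show False by simp
qed

lemma test_function_deriv:
  assumes "test_function \<Omega> \<phi>"
  shows "test_function \<Omega> (deriv \<phi>)"
proof -
  have sub: "closure {x. deriv \<phi> x \<noteq> 0} \<subseteq> closure {x. \<phi> x \<noteq> 0}"
    by (rule closure_minimal) (auto intro: deriv_nonzero_in_closure_support)
  have "(deriv ^^ k) (deriv \<phi>) differentiable_on UNIV" for k
    using assms funpow_swap1[of deriv k \<phi>] unfolding test_function_def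
    by (metis funpow.simps(2) o_apply)
  moreover have "compact (closure {x. deriv \<phi> x \<noteq> 0})"
    using assms bounded_subset[OF _ sub] unfolding test_function_def compact_eq_bounded_closed by simp
  ultimately show ?thesis
    using assms sub unfolding test_function_def by blast
qed

lemma test_function_derivative:
  assumes "test_function \<Omega> \<phi>"
  shows "(\<phi> has_real_derivative deriv \<phi> x) (at x)" "continuous_on A \<phi>"
proof -
  have "(deriv ^^ 0) \<phi> differentiable_on UNIV"
    using assms unfolding test_function_def by blast
  then have d: "\<phi> differentiable_on UNIV" by simp
  then show "(\<phi> has_real_derivative deriv \<phi> x) (at x)"
    by (simp add: differentiable_on_def DERIV_deriv_iff_real_differentiable)
  show "continuous_on A \<phi>"
    using differentiable_imp_continuous_on[OF d] continuous_on_subset by blast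
qed

text \<open>The support of a test function on \<open>\<Omega>\<close> is compact, so all integrals reduce to one interval
  at whose ends the test function vanishes; there the formula is integration by parts.\<close>
lemma weak_deriv_on_1:
  fixes f f1 :: "real \<Rightarrow> real"
  assumes f1: "\<And>x. x > 0 \<Longrightarrow> (f has_real_derivative f1 x) (at x)"
    and c: "continuous_on {0<..} f1"
    and \<Omega>: "\<Omega> \<subseteq> {0<..}"
  shows "weak_deriv_on 1 \<Omega> f f1"
  unfolding weak_deriv_on_def
proof (intro allI impI)
  fix \<phi> assume \<phi>: "test_function \<Omega> \<phi>"
  define K where "K = closure {x. \<phi> x \<noteq> 0}"
  have K: "compact K" "K \<subseteq> \<Omega>"
    using \<phi> unfolding K_def test_function_def by auto
  have "\<exists>\<alpha> \<beta>. 0 < \<alpha> \<and> \<alpha> < \<beta> \<and> K \<subseteq> {\<alpha><..<\<beta>}"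
  proof (cases "K = {}")
    case True
    then show ?thesis by (intro exI[of _ 1] exI[of _ 2]) auto
  next
    case False
    obtain m where m: "m \<in> K" "\<forall>y\<in>K. m \<le> y"
      using compact_attains_inf[OF K(1) False] by auto
    obtain M where M: "M \<in> K" "\<forall>y\<in>K. y \<le> M"
      using compact_attains_sup[OF K(1) False] by auto
    have "m > 0" using m K(2) \<Omega> by auto
    moreover have "m \<le> M" using m M by auto
    moreover have "K \<subseteq> {m / 2<..<M + 1}"
    proof
      fix y assume "y \<in> K"
      then have "m \<le> y" "y \<le> M" using m M by auto
      with \<open>m > 0\<close> show "y \<in> {m / 2<..<M + 1}" by simp
    qed
    ultimately show ?thesis by (intro exI[of _ "m / 2"] exI[of _ "M + 1"]) simp
  qed
  then obtain \<alpha> \<beta> where \<alpha>: "0 < \<alpha>" "\<alpha> < \<beta>" "K \<subseteq> {\<alpha><..<\<beta>}" by blast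
  have z: "\<phi> x = 0" if "x \<notin> K" for x
    using that closure_subset[of "{x. \<phi> x \<noteq> 0}"] unfolding K_def by blast
  have z': "deriv \<phi> x = 0" if "x \<notin> K" for x
    using that deriv_nonzero_in_closure_support unfolding K_def by blast
  have restrict: "(LINT x:\<Omega>|lebesgue. k x) = (LINT x:{\<alpha>..\<beta>}|lebesgue. k x)"
    if "\<And>x. x \<notin> K \<Longrightarrow> k x = 0" for k :: "real \<Rightarrow> real"
  proof -
    have "indicat_real \<Omega> x *\<^sub>R k x = indicat_real {\<alpha>..\<beta>} x *\<^sub>R k x" for x
      using that[of x] K(2) \<alpha>(3) by (cases "x \<in> K") (auto simp: indicator_def)
    then show ?thesis unfolding set_lebesgue_integral_def by (rule Bochner_Integration.integral_cong[OF refl])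
  qed
  have cf: "continuous_on {\<alpha>..\<beta>} f"
    using \<alpha> by (intro continuous_at_imp_continuous_on ballI DERIV_isCont[OF f1]) auto
  have cf1: "continuous_on {\<alpha>..\<beta>} f1"
    using c by (rule continuous_on_subset) (use \<alpha> in auto)
  have cont: "continuous_on {\<alpha>..\<beta>} (\<lambda>x. f x * deriv \<phi> x)" "continuous_on {\<alpha>..\<beta>} (\<lambda>x. f1 x * \<phi> x)"
    using cf cf1 test_function_derivative(2)[OF \<phi>]
      test_function_derivative(2)[OF test_function_deriv[OF \<phi>]]
    by (auto intro!: continuous_intros)
  have "((\<lambda>x. f1 x * \<phi> x + f x * deriv \<phi> x) has_integral f \<beta> * \<phi> \<beta> - f \<alpha> * \<phi> \<alpha>) {\<alpha>..\<beta>}"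
  proof (rule fundamental_theorem_of_calculus)
    fix x assume "x \<in> {\<alpha>..\<beta>}"
    then have "x > 0" using \<alpha> by auto
    have "((\<lambda>x. f x * \<phi> x) has_real_derivative f1 x * \<phi> x + f x * deriv \<phi> x) (at x)"
      using DERIV_mult[OF f1[OF \<open>x > 0\<close>] test_function_derivative(1)[OF \<phi>, of x]]
      by (simp add: algebra_simps)
    then show "((\<lambda>x. f x * \<phi> x) has_vector_derivative f1 x * \<phi> x + f x * deriv \<phi> x)
        (at x within {\<alpha>..\<beta>})"
      unfolding has_real_derivative_iff_has_vector_derivative
      by (rule has_vector_derivative_at_within)
  qed (use \<alpha> in auto)
  moreover have "\<phi> \<alpha> = 0" "\<phi> \<beta> = 0"
    using \<alpha> by (auto intro!: z)
  ultimately have "integral {\<alpha>..\<beta>} (\<lambda>x. f1 x * \<phi> x + f x * deriv \<phi> x) = 0"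
    by (simp add: integral_unique)
  then have "integral {\<alpha>..\<beta>} (\<lambda>x. f1 x * \<phi> x) + integral {\<alpha>..\<beta>} (\<lambda>x. f x * deriv \<phi> x) = 0"
    using cont by (subst (asm) integral_add) (auto intro: integrable_continuous_real)
  moreover have "(LINT x:\<Omega>|lebesgue. f x * deriv \<phi> x) = integral {\<alpha>..\<beta>} (\<lambda>x. f x * deriv \<phi> x)"
    using cont by (subst restrict)
      (auto simp: z' intro!: set_lebesgue_integral_eq_integral(2) absolutely_integrable_continuous_real)
  moreover have "(LINT x:\<Omega>|lebesgue. f1 x * \<phi> x) = integral {\<alpha>..\<beta>} (\<lambda>x. f1 x * \<phi> x)"
    using cont by (subst restrict)
      (auto simp: z intro!: set_lebesgue_integral_eq_integral(2) absolutely_integrable_continuous_real)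
  ultimately show "(LINT x:\<Omega>|lebesgue. f x * (deriv ^^ 1) \<phi> x)
      = (- 1) ^ 1 * (LINT x:\<Omega>|lebesgue. f1 x * \<phi> x)"
    by simp
qed

lemma weak_deriv_on_2:
  fixes f f1 f2 :: "real \<Rightarrow> real"
  assumes f1: "\<And>x. x > 0 \<Longrightarrow> (f has_real_derivative f1 x) (at x)"
    and f2: "\<And>x. x > 0 \<Longrightarrow> (f1 has_real_derivative f2 x) (at x)"
    and c: "continuous_on {0<..} f2"
    and \<Omega>: "\<Omega> \<subseteq> {0<..}"
  shows "weak_deriv_on 2 \<Omega> f f2"
  unfolding weak_deriv_on_def
proof (intro allI impI)
  fix \<phi> assume \<phi>: "test_function \<Omega> \<phi>"
  have c1: "continuous_on {0<..} f1"
    by (intro continuous_at_imp_continuous_on ballI DERIV_isCont[OF f2]) auto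
  have "(LINT x:\<Omega>|lebesgue. f x * (deriv ^^ 1) (deriv \<phi>) x)
      = (- 1) ^ 1 * (LINT x:\<Omega>|lebesgue. f1 x * deriv \<phi> x)"
    using weak_deriv_on_1[OF f1 c1 \<Omega>] test_function_deriv[OF \<phi>]
    unfolding weak_deriv_on_def by blast
  moreover have "(LINT x:\<Omega>|lebesgue. f1 x * (deriv ^^ 1) \<phi> x)
      = (- 1) ^ 1 * (LINT x:\<Omega>|lebesgue. f2 x * \<phi> x)"
    using weak_deriv_on_1[OF f2 c \<Omega>] \<phi> unfolding weak_deriv_on_def by blast
  ultimately show "(LINT x:\<Omega>|lebesgue. f x * (deriv ^^ 2) \<phi> x)
      = (- 1) ^ 2 * (LINT x:\<Omega>|lebesgue. f2 x * \<phi> x)"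
    by (simp add: numeral_2_eq_2)
qed

text \<open>An integrable majorant on the surrounding interval is enough; the set \<open>\<Omega>\<close> itself may be any open
  set, which serves the whole interval and the compactly contained subsets alike.\<close>
lemma Lp_onI:
  fixes f k :: "real \<Rightarrow> real"
  assumes \<Omega>: "open \<Omega>" "\<Omega> \<subseteq> {0<..<R}"
    and c: "continuous_on {0<..} f"
    and k: "k integrable_on {0..R}" "\<And>x. 0 < x \<Longrightarrow> x < R \<Longrightarrow> \<bar>f x\<bar> powr p \<le> k x"
    and k0: "\<And>x. 0 \<le> k x"
  shows "Lp_on p \<Omega> f"
proof -
  have c': "continuous_on \<Omega> f"
    using c by (rule continuous_on_subset) (use \<Omega> in auto)
  have \<Omega>l: "\<Omega> \<in> sets lebesgue"
    using borel_open[OF \<Omega>(1)] sets_completionI_sets[of \<Omega> lborel] by simp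
  have m: "f \<in> borel_measurable (lebesgue_on \<Omega>)"
    using continuous_imp_measurable_on_sets_lebesgue[OF c' \<Omega>l] .
  have sm: "set_borel_measurable lebesgue \<Omega> f"
    using m \<Omega>l unfolding set_borel_measurable_def
    by (subst (asm) borel_measurable_restrict_space_iff) auto
  have "k absolutely_integrable_on {0..R}"
    using k(1) k0 by (intro nonnegative_absolutely_integrable_1) auto
  then have "k absolutely_integrable_on \<Omega>"
    by (rule set_integrable_subset) (use \<Omega> \<Omega>l in auto)
  then have "k integrable_on \<Omega>" by (rule set_lebesgue_integral_eq_integral)
  then have "(\<lambda>x. \<bar>f x\<bar> powr p) absolutely_integrable_on \<Omega>"
    by (rule measurable_bounded_by_integrable_imp_absolutely_integrable[rotated 2])
      (use m \<Omega>l \<Omega>(2) k(2) in \<open>auto intro!: powr_real_measurable borel_measurable_abs\<close>)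
  with sm show ?thesis unfolding Lp_on_def by blast
qed

lemma Lp_on_bounded:
  fixes f :: "real \<Rightarrow> real"
  assumes \<Omega>: "open \<Omega>" "\<Omega> \<subseteq> {0<..<R}"
    and c: "continuous_on {0..} f" and p: "p \<ge> 0"
  shows "Lp_on p \<Omega> f"
proof -
  have "compact (f ` {0..R})"
    by (rule compact_continuous_image[OF continuous_on_subset[OF c]]) auto
  then obtain B where B: "\<And>x. x \<in> {0..R} \<Longrightarrow> \<bar>f x\<bar> \<le> B"
    using compact_imp_bounded bounded_iff by (metis imageI real_norm_def)
  have c': "continuous_on {0<..} f"
    using c by (rule continuous_on_subset) auto
  show ?thesis
    by (rule Lp_onI[OF \<Omega> c', where k = "\<lambda>_. B powr p"])
      (use B p in \<open>auto intro!: powr_mono2\<close>)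
qed

section \<open>The flux of a positive non-decreasing profile\<close>

locale flux_parameters =
  fixes q \<theta> C \<tau> :: real
  assumes q: "q \<ge> 0" and \<theta>: "\<theta> > 0" and C: "C > 0" and \<tau>: "\<tau> \<ge> \<theta> * q + 1"
begin

text \<open>The right-hand side of the equation depends on the unknown \<open>v\<close> only through \<open>h = g \<circ> v\<close>. The equation
  says that \<open>v\<close> has derivative \<open>flux h\<close>.\<close>
definition mass :: "(real \<Rightarrow> real) \<Rightarrow> real \<Rightarrow> real" where
  "mass h r = integral {0..r} (\<lambda>s. s powr (\<tau> - 1) * h s)"

definition flux :: "(real \<Rightarrow> real) \<Rightarrow> real \<Rightarrow> real" where
  "flux h r = C * r powr (- q) * mass h r powr (1 / \<theta>)"

text \<open>The derivative of \<open>flux h\<close>, factored so that for \<open>r > 0\<close> its sign is that of the bracket.\<close>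
definition flux' :: "(real \<Rightarrow> real) \<Rightarrow> real \<Rightarrow> real" where
  "flux' h r = C * r powr (- q - 1) * mass h r powr (1 / \<theta> - 1) * (r powr \<tau> * h r / \<theta> - q * mass h r)"

text \<open>Dividing the mass by its order of growth \<open>r powr \<tau>\<close> leaves a quantity that stays between positive
  bounds as \<open>r\<close> tends to \<open>0\<close>. All behaviour at the origin is expressed by it.\<close>
definition ratio :: "(real \<Rightarrow> real) \<Rightarrow> real \<Rightarrow> real" where
  "ratio h r = mass h r / r powr \<tau>"

definition profile :: "(real \<Rightarrow> real) \<Rightarrow> bool" where
  "profile h \<longleftrightarrow> continuous_on {0..} h \<and> mono_on {0..} h \<and> (\<forall>r\<ge>0. 0 < h r)"

lemma profileD:
  assumes "profile h"
  shows "continuous_on {0..} h" "0 \<le> r \<Longrightarrow> r \<le> s \<Longrightarrow> h r \<le> h s" "0 \<le> r \<Longrightarrow> 0 < h r"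
  using assms mono_onD[of "{0..}" h r s] unfolding profile_def by simp_all

lemma \<tau>_ge_1: "\<tau> \<ge> 1"
  using \<tau> mult_nonneg_nonneg[of \<theta> q] \<theta> q by linarith

lemma \<tau>_gt: "\<theta> * q < \<tau>"
  using \<tau> by linarith

lemma exponent_pos: "\<tau> / \<theta> - q > 0"
  using \<tau>_gt \<theta> by (simp add: field_simps)

text \<open>For \<open>\<tau> = 1\<close> the weight jumps at \<open>0\<close> because \<open>0 powr 0 = 0\<close>; with the value \<open>1\<close> there it is
  continuous in all cases.\<close>
lemma continuous_integrand:
  assumes "continuous_on S h" "S \<subseteq> {0..}"
  shows "continuous_on S (\<lambda>s. (if \<tau> = 1 then 1 else s powr (\<tau> - 1)) * h s)"
proof (cases "\<tau> = 1")
  case True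
  then show ?thesis using assms(1) by simp
next
  case False
  then have "\<tau> - 1 > 0" using \<tau>_ge_1 by simp
  then have "continuous_on S (\<lambda>s. s powr (\<tau> - 1))"
    using assms(2) by (intro continuous_on_powr' continuous_intros) auto
  with False assms(1) show ?thesis by (auto intro: continuous_on_mult)
qed

lemma integrand_integrable:
  assumes "continuous_on {0..r} h"
  shows "(\<lambda>s. s powr (\<tau> - 1) * h s) integrable_on {0..r}"
  by (rule integrable_spike_finite[of "{0}" _ _ "\<lambda>s. (if \<tau> = 1 then 1 else s powr (\<tau> - 1)) * h s"])
    (use assms in \<open>auto intro!: integrable_continuous_real continuous_integrand\<close>)

lemma profile_integrable:
  assumes "profile h"
  shows "(\<lambda>s. s powr (\<tau> - 1) * h s) integrable_on {0..r}"
  by (rule integrand_integrable[OF continuous_on_subset[OF profileD(1)[OF assms]]]) auto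

lemma weight_has_integral:
  assumes "r \<ge> 0"
  shows "((\<lambda>s. s powr (\<tau> - 1) * m) has_integral r powr \<tau> / \<tau> * m) {0..r}"
  using has_integral_powr_from_0[of "\<tau> - 1" r, THEN has_integral_mult_left] assms \<tau>_ge_1 by simp

text \<open>By monotonicity \<open>h\<close> lies between \<open>h 0\<close> and \<open>h r\<close> on the interval of integration.\<close>
lemma mass_bounds:
  assumes "profile h" "r \<ge> 0"
  shows "r powr \<tau> / \<tau> * h 0 \<le> mass h r" "mass h r \<le> r powr \<tau> / \<tau> * h r"
proof -
  have m: "((\<lambda>s. s powr (\<tau> - 1) * h s) has_integral mass h r) {0..r}"
    unfolding mass_def using profile_integrable[OF assms(1)] by (rule integrable_integral)
  show "r powr \<tau> / \<tau> * h 0 \<le> mass h r"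
    by (rule has_integral_le[OF weight_has_integral m])
      (use assms profileD(2)[OF assms(1)] in \<open>auto intro: mult_left_mono\<close>)
  show "mass h r \<le> r powr \<tau> / \<tau> * h r"
    by (rule has_integral_le[OF m weight_has_integral])
      (use assms profileD(2)[OF assms(1)] in \<open>auto intro: mult_left_mono\<close>)
qed

lemma mass_pos:
  assumes "profile h" "r > 0"
  shows "mass h r > 0"
proof -
  have "r powr \<tau> / \<tau> * h 0 > 0"
    using assms profileD(3)[OF assms(1), of 0] \<tau>_ge_1 by auto
  then show ?thesis using mass_bounds(1)[OF assms(1), of r] assms(2) by linarith
qed

lemma mass_nonneg: "profile h \<Longrightarrow> mass h r \<ge> 0"
  using mass_pos[of h r] by (cases "r > 0"; cases "r = 0") (simp_all add: mass_def less_imp_le)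

lemma mass_mono:
  assumes "profile h" "profile k" "\<And>s. 0 \<le> s \<Longrightarrow> s \<le> r \<Longrightarrow> h s \<le> k s"
  shows "mass h r \<le> mass k r"
  unfolding mass_def
  by (rule integral_le) (use assms profile_integrable in \<open>auto intro: mult_left_mono\<close>)

lemma mass_has_derivative:
  assumes h: "profile h" and r: "r > 0"
  shows "(mass h has_real_derivative r powr (\<tau> - 1) * h r) (at r)"
proof -
  let ?k = "\<lambda>s. (if \<tau> = 1 then 1 else s powr (\<tau> - 1)) * h s"
  have eq: "mass h x = integral {0..x} ?k" for x
    unfolding mass_def by (rule integral_spike[of "{0}"]) auto
  have "continuous_on {0..} ?k"
    by (rule continuous_integrand[OF profileD(1)[OF h]]) auto
  then have "((\<lambda>x. integral {0..x} ?k) has_real_derivative ?k r) (at r within {0..})"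
    by (rule integral_has_real_derivative_Ici) (use r in simp)
  moreover have "?k r = r powr (\<tau> - 1) * h r" using r by simp
  moreover have "mass h = (\<lambda>x. integral {0..x} ?k)" using eq by blast
  ultimately show ?thesis using at_within_Ici_interior[OF r] by simp
qed

lemma flux_0 [simp]: "flux h 0 = 0"
  by (simp add: flux_def)

lemma flux_mono:
  assumes "profile h" "profile k" "\<And>s. 0 \<le> s \<Longrightarrow> s \<le> r \<Longrightarrow> h s \<le> k s"
  shows "flux h r \<le> flux k r"
  unfolding flux_def
  using mass_mono[OF assms] mass_nonneg[OF assms(1)] C \<theta>
  by (intro mult_left_mono powr_mono2) auto

lemma flux_nonneg: "flux h r \<ge> 0"
  using C by (simp add: flux_def)

lemma flux_pos: "profile h \<Longrightarrow> r > 0 \<Longrightarrow> flux h r > 0"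
  using C mass_pos[of h r] by (simp add: flux_def)

lemma flux_has_derivative:
  assumes h: "profile h" and r: "r > 0"
  shows "(flux h has_real_derivative flux' h r) (at r)"
proof -
  have m: "mass h r > 0" using mass_pos[OF assms] .
  have d: "((\<lambda>r. C * r powr (- q) * mass h r powr (1 / \<theta>)) has_real_derivative
      C * (r powr (- q) * (mass h r powr (1 / \<theta>) * (0 * ln (mass h r) +
        (r powr (\<tau> - 1) * h r) * (1 / \<theta>) / mass h r))
       + (r powr (- q) * (0 * ln r + 1 * (- q) / r)) * mass h r powr (1 / \<theta>))) (at r)"
    using DERIV_cmult[OF DERIV_mult[OF DERIV_powr[OF DERIV_ident r DERIV_const]
       DERIV_powr[OF mass_has_derivative[OF assms] m DERIV_const]], of C "- q" "1 / \<theta>"]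
    by (simp add: algebra_simps)
  have "r powr \<tau> = r powr (\<tau> - 1) * r" "r powr (- q) = r powr (- q - 1) * r"
    "mass h r powr (1 / \<theta>) = mass h r powr (1 / \<theta> - 1) * mass h r"
    using r m by (simp_all add: powr_diff)
  then have "C * (r powr (- q) * (mass h r powr (1 / \<theta>) * (0 * ln (mass h r) +
        (r powr (\<tau> - 1) * h r) * (1 / \<theta>) / mass h r))
       + (r powr (- q) * (0 * ln r + 1 * (- q) / r)) * mass h r powr (1 / \<theta>)) = flux' h r"
    unfolding flux'_def using r m \<theta> by (simp add: field_simps)
  moreover have "flux h = (\<lambda>r. C * r powr (- q) * mass h r powr (1 / \<theta>))"
    by (auto simp: flux_def)
  ultimately show ?thesis using d by simp
qed

text \<open>This is where convexity comes from: the upper bound of the mass costs the factor \<open>q / \<tau>\<close>, which is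
  smaller than \<open>1 / \<theta>\<close>.\<close>
lemma bracket_ge:
  assumes h: "profile h" and r: "r > 0"
  shows "r powr \<tau> * h r * (1 / \<theta> - q / \<tau>) \<le> r powr \<tau> * h r / \<theta> - q * mass h r"
proof -
  have "q * mass h r \<le> q * (r powr \<tau> / \<tau> * h r)"
    using mass_bounds(2)[OF h, of r] r q by (intro mult_left_mono) auto
  then show ?thesis by (simp add: algebra_simps)
qed

lemma bracket_factor_pos: "1 / \<theta> - q / \<tau> > 0"
  using \<tau>_gt \<theta> \<tau>_ge_1 by (simp add: field_simps)

lemma flux'_pos:
  assumes h: "profile h" and r: "r > 0"
  shows "flux' h r > 0"
proof -
  have "r powr \<tau> * h r * (1 / \<theta> - q / \<tau>) > 0"
    using bracket_factor_pos r profileD(3)[OF h, of r] by (intro mult_pos_pos) auto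
  then have "r powr \<tau> * h r / \<theta> - q * mass h r > 0"
    using bracket_ge[OF assms] by linarith
  then show ?thesis
    unfolding flux'_def using C r mass_pos[OF assms] by (intro mult_pos_pos) auto
qed

lemma ratio_bounds:
  assumes h: "profile h" and r: "r > 0"
  shows "h 0 / \<tau> \<le> ratio h r" "ratio h r \<le> h r / \<tau>"
  using mass_bounds[OF h, of r] r by (simp_all add: ratio_def pos_le_divide_eq pos_divide_le_eq mult.commute)

lemma ratio_pos:
  assumes "profile h" "r > 0"
  shows "ratio h r > 0"
  using mass_pos[OF assms] assms(2) by (simp add: ratio_def)

text \<open>The substitution \<open>mass h r = r powr \<tau> * ratio h r\<close> isolates the power of \<open>r\<close> that governs the flux.\<close>
lemma flux_eq:
  assumes h: "profile h" and r: "r > 0"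
  shows "flux h r = C * r powr (\<tau> / \<theta> - q) * ratio h r powr (1 / \<theta>)"
proof -
  have "mass h r = r powr \<tau> * ratio h r" using r by (simp add: ratio_def)
  then have "mass h r powr (1 / \<theta>) = r powr (\<tau> / \<theta>) * ratio h r powr (1 / \<theta>)"
    using ratio_pos[OF assms] by (simp add: powr_mult powr_powr)
  then show ?thesis unfolding flux_def by (simp add: powr_diff powr_minus field_simps)
qed

lemma flux'_eq:
  assumes h: "profile h" and r: "r > 0"
  shows "flux' h r =
    C * r powr (\<tau> / \<theta> - q - 1) * (ratio h r powr (1 / \<theta> - 1) * (h r / \<theta> - q * ratio h r))"
proof -
  have m: "mass h r = r powr \<tau> * ratio h r" using r by (simp add: ratio_def)
  then have "mass h r powr (1 / \<theta> - 1) = r powr (\<tau> * (1 / \<theta> - 1)) * ratio h r powr (1 / \<theta> - 1)"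
    using ratio_pos[OF assms] by (simp add: powr_mult powr_powr)
  moreover have "r powr \<tau> * h r / \<theta> - q * mass h r = r powr \<tau> * (h r / \<theta> - q * ratio h r)"
    by (simp add: m algebra_simps)
  moreover have "r powr (- q - 1) * (r powr (\<tau> * (1 / \<theta> - 1)) * r powr \<tau>) = r powr (\<tau> / \<theta> - q - 1)"
    unfolding powr_add[symmetric] by (simp add: algebra_simps)
  ultimately show ?thesis unfolding flux'_def by (simp add: mult.assoc)
qed

lemma powr_pred: "y > 0 \<Longrightarrow> y powr p = y powr (p - 1) * (y :: real)"
  by (simp add: powr_diff)

lemma at_0_Ici: "at (0::real) within {0..} = at_right 0"
  using at_within_Icc_at_right[of 0 "1::real"] at_within_Ici_eq_Icc[of 0 1] by simp

lemma profile_tendsto_0: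
  assumes h: "profile h"
  shows "(h \<longlongrightarrow> h 0) (at_right 0)"
  using profileD(1)[OF h] unfolding continuous_on_def at_0_Ici[symmetric] by auto

lemma ratio_tendsto:
  assumes h: "profile h"
  shows "(ratio h \<longlongrightarrow> h 0 / \<tau>) (at_right 0)"
proof (rule tendsto_sandwich)
  show "\<forall>\<^sub>F r in at_right 0. h 0 / \<tau> \<le> ratio h r"
    "\<forall>\<^sub>F r in at_right 0. ratio h r \<le> h r / \<tau>"
    using ratio_bounds[OF h] by (auto simp: eventually_at_filter)
  show "((\<lambda>r. h r / \<tau>) \<longlongrightarrow> h 0 / \<tau>) (at_right 0)"
    using \<tau>_ge_1 by (intro tendsto_intros profile_tendsto_0[OF h]) auto
qed simp

lemma id_tendsto_0: "((\<lambda>r. r) \<longlongrightarrow> (0::real)) (at_right 0)"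
  by (rule tendsto_ident_at)

lemma powr_tendsto_0:
  assumes "e > 0"
  shows "((\<lambda>r::real. r powr e) \<longlongrightarrow> 0) (at_right 0)"
proof -
  have "((\<lambda>r::real. r powr e) \<longlongrightarrow> 0 powr e) (at_right 0)"
    by (rule tendsto_powr'[OF id_tendsto_0 tendsto_const])
      (use assms in \<open>auto simp: eventually_at_filter\<close>)
  then show ?thesis by simp
qed

lemma ratio_root_tendsto:
  assumes h: "profile h"
  shows "((\<lambda>r. ratio h r powr p) \<longlongrightarrow> (h 0 / \<tau>) powr p) (at_right 0)"
  by (rule tendsto_powr'[OF ratio_tendsto[OF h] tendsto_const])
    (use profileD(3)[OF h, of 0] \<tau>_ge_1 in auto)

lemma flux_tendsto_0:
  assumes h: "profile h"
  shows "(flux h \<longlongrightarrow> 0) (at_right 0)"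
proof -
  have "((\<lambda>r. C * r powr (\<tau> / \<theta> - q) * ratio h r powr (1 / \<theta>)) \<longlongrightarrow>
      C * 0 * (h 0 / \<tau>) powr (1 / \<theta>)) (at_right 0)"
    by (intro tendsto_intros powr_tendsto_0 exponent_pos ratio_root_tendsto h)
  then have "((\<lambda>r. C * r powr (\<tau> / \<theta> - q) * ratio h r powr (1 / \<theta>)) \<longlongrightarrow> 0) (at_right 0)"
    by simp
  then show ?thesis
    by (rule Lim_transform_eventually) (auto simp: eventually_at_filter flux_eq[OF h])
qed

lemma continuous_flux:
  assumes h: "profile h"
  shows "continuous_on {0..} (flux h)"
  unfolding continuous_on_def
proof
  fix x :: real assume "x \<in> {0..}"
  then consider "x = 0" | "x > 0" by fastforce
  then show "(flux h \<longlongrightarrow> flux h x) (at x within {0..})"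
  proof cases
    case 1
    then show ?thesis using flux_tendsto_0[OF h] by (simp add: at_0_Ici)
  next
    case 2
    then show ?thesis
      using DERIV_isCont[OF flux_has_derivative[OF h 2]] at_within_Ici_interior[OF 2]
      by (simp add: isCont_def)
  qed
qed

lemma continuous_flux':
  assumes h: "profile h"
  shows "continuous_on {0<..} (flux' h)"
proof -
  have m: "continuous_on {0<..} (mass h)"
    by (intro continuous_at_imp_continuous_on ballI DERIV_isCont[OF mass_has_derivative[OF h]]) auto
  have hc: "continuous_on {0<..} h"
    by (rule continuous_on_subset[OF profileD(1)[OF h]]) auto
  show ?thesis
    unfolding flux'_def
    by (intro continuous_intros m hc) (use mass_pos[OF h] \<theta> in \<open>fastforce+\<close>)
qed

text \<open>By \<open>flux'_eq\<close> this is the cofactor of \<open>r powr (\<tau> / \<theta> - q - 1)\<close> in the second derivative. Its limit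
  is positive, so the sign of that exponent alone decides how regular a solution is at \<open>0\<close>.\<close>
lemma flux'_scaled_tendsto:
  assumes h: "profile h"
  shows "((\<lambda>r. ratio h r powr (1 / \<theta> - 1) * (h r / \<theta> - q * ratio h r)) \<longlongrightarrow>
    (h 0 / \<tau>) powr (1 / \<theta>) * (\<tau> / \<theta> - q)) (at_right 0)"
proof -
  have "(h 0 / \<tau>) powr (1 / \<theta>) * (\<tau> / \<theta> - q) =
      (h 0 / \<tau>) powr (1 / \<theta> - 1) * (h 0 / \<theta> - q * (h 0 / \<tau>))"
  proof -
    have y: "h 0 / \<tau> > 0" using profileD(3)[OF h, of 0] \<tau>_ge_1 by simp
    then have "(h 0 / \<tau>) powr (1 / \<theta>) = (h 0 / \<tau>) powr (1 / \<theta> - 1) * (h 0 / \<tau>)"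
      by (rule powr_pred)
    moreover have "(h 0 / \<tau>) * (\<tau> / \<theta> - q) = h 0 / \<theta> - q * (h 0 / \<tau>)"
      using \<tau>_ge_1 by (simp add: field_simps)
    ultimately show ?thesis by (metis mult.assoc)
  qed
  moreover have "((\<lambda>r. ratio h r powr (1 / \<theta> - 1) * (h r / \<theta> - q * ratio h r)) \<longlongrightarrow>
      (h 0 / \<tau>) powr (1 / \<theta> - 1) * (h 0 / \<theta> - q * (h 0 / \<tau>))) (at_right 0)"
    by (intro tendsto_intros ratio_root_tendsto ratio_tendsto profile_tendsto_0 h) (use \<theta> in simp)
  ultimately show ?thesis by simp
qed

text \<open>The expression in the hypothesis is the difference quotient of the flux at \<open>0\<close>.\<close>
lemma flux_slope_tendsto:
  assumes h: "profile h"
    and L: "((\<lambda>r. C * r powr (\<tau> / \<theta> - q - 1) * ratio h r powr (1 / \<theta>)) \<longlongrightarrow> L) (at_right 0)"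
  shows "(flux h has_real_derivative L) (at 0 within {0..})"
proof -
  have "((\<lambda>r. (flux h r - flux h 0) / (r - 0)) \<longlongrightarrow> L) (at_right 0)"
  proof (rule Lim_transform_eventually[OF L])
    show "\<forall>\<^sub>F r in at_right 0. C * r powr (\<tau> / \<theta> - q - 1) * ratio h r powr (1 / \<theta>) =
        (flux h r - flux h 0) / (r - 0)"
      by (auto simp: eventually_at_filter flux_eq[OF h] powr_diff)
  qed
  then show ?thesis by (simp add: has_field_derivative_iff at_0_Ici)
qed

end

section \<open>Solutions and their regularity at the origin\<close>

locale cauchy_problem = flux_parameters +
  fixes g :: "real \<Rightarrow> real"
  assumes g_pos: "\<And>x. g x > 0" and g_mono: "mono g" and g_cont: "continuous_on UNIV g"
begin

lemma profile_comp:
  assumes "continuous_on {0..} v" "mono_on {0..} v"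
  shows "profile (\<lambda>s. g (v s))"
  unfolding profile_def
proof (intro conjI)
  show "continuous_on {0..} (\<lambda>s. g (v s))"
    by (rule continuous_on_compose2[OF g_cont assms(1)]) simp
  show "mono_on {0..} (\<lambda>s. g (v s))"
    using assms(2) g_mono by (auto simp: mono_on_def mono_def)
qed (simp add: g_pos)

text \<open>With \<open>convex_solutionI\<close> below, this replaces the notion of solution by one equation, that \<open>v\<close> has the
  one-sided derivative \<open>flux (g \<circ> v)\<close> on the closed half-line. It holds at \<open>0\<close> because both \<open>v'(0)\<close> and the
  flux vanish there; since the flux is nonnegative, \<open>v\<close> is non-decreasing and \<open>g \<circ> v\<close> is a profile.\<close>
lemma convex_solution_profile:
  assumes "convex_solution g q \<theta> C \<tau> a v"
  shows "v 0 = a" "profile (\<lambda>s. g (v s))"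
    "\<And>r. r \<ge> 0 \<Longrightarrow> (v has_real_derivative flux (\<lambda>s. g (v s)) r) (at r within {0..})"
proof -
  note * = assms[unfolded convex_solution_def solves_cauchy_def Ck_on_1_eq]
  show "v 0 = a" using * by blast
  have d: "(v has_real_derivative deriv_on {0..} v r) (at r within {0..})" if "r \<ge> 0" for r
    by (rule has_real_derivative_deriv_on) (use * that at_within_Ici_neq_bot in auto)
  have eq: "deriv_on {0..} v r = flux (\<lambda>s. g (v s)) r" if "r \<ge> 0" for r
  proof (cases "r = 0")
    case True
    then show ?thesis using * by simp
  next
    case False
    then have "r > 0" using that by simp
    then show ?thesis using * unfolding flux_def mass_def by blast
  qed
  show d': "(v has_real_derivative flux (\<lambda>s. g (v s)) r) (at r within {0..})" if "r \<ge> 0" for r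
    using d[OF that] eq[OF that] by simp
  have c: "continuous_on {0..} v"
    using * differentiable_imp_continuous_on by blast
  have "v x \<le> v y" if "0 \<le> x" "x \<le> y" for x y
  proof (rule DERIV_nonneg_imp_increasing_open[OF that(2)])
    show "continuous_on {x..y} v" by (rule continuous_on_subset[OF c]) (use that in auto)
    fix r assume "x < r" "r < y"
    then have "r > 0" using that by simp
    then show "\<exists>D. (v has_real_derivative D) (at r) \<and> 0 \<le> D"
      using d'[of r] at_within_Ici_interior[of r] flux_nonneg by auto
  qed
  then have "mono_on {0..} v" by (auto simp: mono_on_def)
  with c show "profile (\<lambda>s. g (v s))" by (rule profile_comp)
qed

lemma solution_Ck_2_interior:
  assumes h: "profile h"
    and d: "\<And>r. r \<ge> 0 \<Longrightarrow> (v has_real_derivative flux h r) (at r within {0..})"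
  shows "Ck_on 2 {0<..} v"
proof (rule second_derivative_on(1))
  fix x :: real assume x: "x \<in> {0<..}"
  then have "at x within {0<..} = at x" by (intro at_within_open) auto
  then show "at x within {0<..} \<noteq> bot"
    "(v has_real_derivative flux h x) (at x within {0<..})"
    "(flux h has_real_derivative flux' h x) (at x within {0<..})"
    using x d[of x] flux_has_derivative[OF h, of x] at_within_Ici_interior[of x] by auto
qed (rule continuous_flux'[OF h])

lemma convex_solutionI:
  assumes a: "v 0 = a" and h: "profile (\<lambda>s. g (v s))"
    and d: "\<And>r. r \<ge> 0 \<Longrightarrow> (v has_real_derivative flux (\<lambda>s. g (v s)) r) (at r within {0..})"
  shows "convex_solution g q \<theta> C \<tau> a v"
proof -
  let ?h = "\<lambda>s. g (v s)"
  have eq: "deriv_on {0..} v r = flux ?h r" if "r \<ge> 0" for r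
    using deriv_on_eqI[OF d[OF that]] at_within_Ici_neq_bot[OF that] by blast
  have eq2: "deriv_on {0..} (deriv_on {0..} v) r = flux' ?h r" if "r > 0" for r
  proof (rule deriv_on_eqI)
    show "(deriv_on {0..} v has_real_derivative flux' ?h r) (at r within {0..})"
      by (rule has_real_derivative_on_cong[where f = "flux ?h"])
        (use flux_has_derivative[OF h that] that eq at_within_Ici_interior[of r] in auto)
    show "at r within {0..} \<noteq> bot" using that by (intro at_within_Ici_neq_bot) simp
  qed
  have "Ck_on 1 {0..} v"
    unfolding Ck_on_1_eq
  proof
    show "v differentiable_on {0..}" using d by (intro differentiable_onI_real) auto
    show "continuous_on {0..} (deriv_on {0..} v)"
      by (rule continuous_on_eq[OF continuous_flux[OF h]]) (simp add: eq)
  qed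
  moreover have "solves_cauchy g q \<theta> C \<tau> a v"
    unfolding solves_cauchy_def using a eq by (simp add: flux_def mass_def)
  ultimately show ?thesis
    unfolding convex_solution_def
    using solution_Ck_2_interior[OF h d] eq eq2 flux_pos[OF h] flux'_pos[OF h] by simp
qed

text \<open>This covers two cases: \<open>l = 0\<close> for a positive exponent, and \<open>l = 1\<close> for the exponent \<open>0\<close>, where
  \<open>\<tau> / \<theta> - q = 1\<close>. The second hypothesis on \<open>l\<close>, true in both, makes the limit of \<open>flux' h\<close> at \<open>0\<close> agree with the
  difference quotient of \<open>flux h\<close> there.\<close>
lemma solution_Ck_2:
  assumes h: "profile h"
    and d: "\<And>r. r \<ge> 0 \<Longrightarrow> (v has_real_derivative flux h r) (at r within {0..})"
    and l: "((\<lambda>r. r powr (\<tau> / \<theta> - q - 1)) \<longlongrightarrow> l) (at_right 0)" "l * (\<tau> / \<theta> - q) = l"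
  shows "Ck_on 2 {0..} v" "deriv_on {0..} (deriv_on {0..} v) 0 = C * l * (h 0 / \<tau>) powr (1 / \<theta>)"
proof -
  define L where "L = C * l * (h 0 / \<tau>) powr (1 / \<theta>)"
  define f2 where "f2 r = (if r = 0 then L else flux' h r)" for r
  have "((\<lambda>r. C * r powr (\<tau> / \<theta> - q - 1) * ratio h r powr (1 / \<theta>)) \<longlongrightarrow> L) (at_right 0)"
    unfolding L_def by (intro tendsto_intros l ratio_root_tendsto h)
  then have d0: "(flux h has_real_derivative L) (at 0 within {0..})"
    by (rule flux_slope_tendsto[OF h])
  have d2: "(flux h has_real_derivative f2 r) (at r within {0..})" if "r \<in> {0..}" for r
    using that d0 flux_has_derivative[OF h, of r] at_within_Ici_interior[of r]
    by (cases "r = 0") (auto simp: f2_def)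
  have "((\<lambda>r. C * r powr (\<tau> / \<theta> - q - 1) * (ratio h r powr (1 / \<theta> - 1) * (h r / \<theta> - q * ratio h r)))
      \<longlongrightarrow> C * l * ((h 0 / \<tau>) powr (1 / \<theta>) * (\<tau> / \<theta> - q))) (at_right 0)"
    by (intro tendsto_mult tendsto_const l flux'_scaled_tendsto h)
  also have "C * l * ((h 0 / \<tau>) powr (1 / \<theta>) * (\<tau> / \<theta> - q)) = C * (h 0 / \<tau>) powr (1 / \<theta>) * (l * (\<tau> / \<theta> - q))"
    by (simp only: mult_ac)
  also have "\<dots> = L" by (simp only: l(2) L_def mult_ac)
  finally have "(f2 \<longlongrightarrow> L) (at_right 0)"
    by (rule Lim_transform_eventually) (auto simp: eventually_at_filter f2_def flux'_eq[OF h])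
  then have lim0: "(f2 \<longlongrightarrow> f2 0) (at 0 within {0..})"
    by (simp add: at_0_Ici f2_def)
  have c: "continuous_on {0..} f2"
    unfolding continuous_on_def
  proof
    fix r :: real assume "r \<in> {0..}"
    then consider "r = 0" | "r > 0" by fastforce
    then show "(f2 \<longlongrightarrow> f2 r) (at r within {0..})"
    proof cases
      case 1
      then show ?thesis using lim0 by simp
    next
      case 2
      have "continuous_on {0<..} f2"
        using continuous_flux'[OF h] by (rule continuous_on_eq) (simp add: f2_def)
      then have "isCont f2 r"
        using 2 by (simp add: continuous_on_eq_continuous_at)
      then show ?thesis using at_within_Ici_interior[OF 2] by (simp add: isCont_def)
    qed
  qed
  show "Ck_on 2 {0..} v"
    by (rule second_derivative_on(1)[OF _ _ d2 c]) (use d at_within_Ici_neq_bot in auto)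
  have "deriv_on {0..} (deriv_on {0..} v) 0 = f2 0"
    by (rule second_derivative_on(2)[OF _ _ d2 c]) (use d at_within_Ici_neq_bot in auto)
  then show "deriv_on {0..} (deriv_on {0..} v) 0 = C * l * (h 0 / \<tau>) powr (1 / \<theta>)"
    by (simp add: f2_def L_def)
qed

text \<open>The ratio lies between two positive numbers. As the exponent \<open>1 / \<theta> - 1\<close> can have either sign, its
  power is bounded by the sum of the powers of both.\<close>
lemma flux'_le_powr:
  assumes h: "profile h"
  obtains B where "B \<ge> 0" "\<And>r. 0 < r \<Longrightarrow> r < R \<Longrightarrow> \<bar>flux' h r\<bar> \<le> B * r powr (\<tau> / \<theta> - q - 1)"
proof -
  define p where "p = 1 / \<theta> - 1"
  define B where "B = C * (((h 0 / \<tau>) powr p + (h R / \<tau>) powr p) * (\<bar>h R\<bar> / \<theta>))"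
  have "B \<ge> 0" unfolding B_def using C \<theta> by simp
  moreover have "\<bar>flux' h r\<bar> \<le> B * r powr (\<tau> / \<theta> - q - 1)" if r: "0 < r" "r < R" for r
  proof -
    have hr: "h r \<le> h R" "h 0 > 0" "h r > 0" using r profileD[OF h] by auto
    have b: "h 0 / \<tau> \<le> ratio h r" "ratio h r \<le> h r / \<tau>" "h r / \<tau> \<le> h R / \<tau>" "h 0 / \<tau> > 0"
      using ratio_bounds[OF h r(1)] hr \<tau>_ge_1 by (auto intro: divide_right_mono)
    have 1: "ratio h r powr p \<le> (h 0 / \<tau>) powr p + (h R / \<tau>) powr p"
    proof (cases "p \<ge> 0")
      case True
      then have "ratio h r powr p \<le> (h R / \<tau>) powr p" using b by (intro powr_mono2) auto
      then show ?thesis by (simp add: add_increasing)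
    next
      case False
      then have "ratio h r powr p \<le> (h 0 / \<tau>) powr p" using b by (intro powr_mono2') auto
      then show ?thesis by (simp add: add_increasing2)
    qed
    have "0 \<le> q * ratio h r" using q b by simp
    then have 2: "h r / \<theta> - q * ratio h r \<le> \<bar>h R\<bar> / \<theta>"
      using hr \<theta> divide_right_mono[of "h r" "\<bar>h R\<bar>" \<theta>] by linarith
    have pos: "flux' h r > 0" using flux'_pos[OF h r(1)] .
    have "ratio h r powr p * (h r / \<theta> - q * ratio h r)
        \<le> ((h 0 / \<tau>) powr p + (h R / \<tau>) powr p) * (\<bar>h R\<bar> / \<theta>)"
    proof -
      have "ratio h r powr p * (h r / \<theta> - q * ratio h r) \<le> ratio h r powr p * (\<bar>h R\<bar> / \<theta>)"
        by (rule mult_left_mono[OF 2]) simp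
      also have "\<dots> \<le> ((h 0 / \<tau>) powr p + (h R / \<tau>) powr p) * (\<bar>h R\<bar> / \<theta>)"
        by (rule mult_right_mono[OF 1]) (use \<theta> in simp)
      finally show ?thesis .
    qed
    then have "C * r powr (\<tau> / \<theta> - q - 1) * (ratio h r powr p * (h r / \<theta> - q * ratio h r))
        \<le> C * r powr (\<tau> / \<theta> - q - 1) * (((h 0 / \<tau>) powr p + (h R / \<tau>) powr p) * (\<bar>h R\<bar> / \<theta>))"
      using C by (intro mult_left_mono) auto
    also have "\<dots> = B * r powr (\<tau> / \<theta> - q - 1)" by (simp add: B_def mult_ac)
    finally show ?thesis using pos flux'_eq[OF h r(1)] by (simp add: p_def)
  qed
  ultimately show ?thesis by (rule that)
qed

text \<open>The condition on \<open>\<delta>\<close> makes the \<open>\<delta>\<close>-th power of the majorant from \<open>flux'_le_powr\<close> integrable at \<open>0\<close>.\<close>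
lemma solution_sobolev:
  assumes h: "profile h"
    and d: "\<And>r. r \<ge> 0 \<Longrightarrow> (v has_real_derivative flux h r) (at r within {0..})"
    and \<Omega>: "open \<Omega>" "\<Omega> \<subseteq> {0<..<R}" and R: "R > 0"
    and \<delta>: "\<delta> > 0" "(\<tau> / \<theta> - q - 1) * \<delta> > - 1"
  shows "sobolev 2 \<delta> \<Omega> v"
proof -
  let ?e = "\<tau> / \<theta> - q - 1"
  have d1: "(v has_real_derivative flux h r) (at r)" if "r > 0" for r
    using d[of r] that at_within_Ici_interior[OF that] by simp
  have d2: "(flux h has_real_derivative flux' h r) (at r)" if "r > 0" for r
    using flux_has_derivative[OF h that] .
  have \<Omega>0: "\<Omega> \<subseteq> {0<..}" using \<Omega>(2) by auto
  have cv: "continuous_on {0..} v"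
    using d differentiable_onI_real[of "{0..}" v] by (auto intro: differentiable_imp_continuous_on)
  have cf: "continuous_on {0<..} (flux h)"
    by (rule continuous_on_subset[OF continuous_flux[OF h]]) auto
  have "Lp_on \<delta> \<Omega> v" "Lp_on \<delta> \<Omega> (flux h)"
    using Lp_on_bounded[OF \<Omega>] cv continuous_flux[OF h] \<delta> by auto
  moreover have "Lp_on \<delta> \<Omega> (flux' h)"
  proof -
    obtain B where B: "B \<ge> 0" "\<And>r. 0 < r \<Longrightarrow> r < R \<Longrightarrow> \<bar>flux' h r\<bar> \<le> B * r powr ?e"
      using flux'_le_powr[OF h] by blast
    show ?thesis
    proof (rule Lp_onI[OF \<Omega> continuous_flux'[OF h], where k = "\<lambda>x. B powr \<delta> * x powr (?e * \<delta>)"])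
      show "(\<lambda>x. B powr \<delta> * x powr (?e * \<delta>)) integrable_on {0..R}"
        using has_integral_powr_from_0[OF \<delta>(2), of R] R
        by (intro integrable_on_mult_right) (auto simp: integrable_on_def)
      fix x :: real assume "0 < x" "x < R"
      then have "\<bar>flux' h x\<bar> powr \<delta> \<le> (B * x powr ?e) powr \<delta>"
        using B \<delta> by (intro powr_mono2) auto
      also have "\<dots> = B powr \<delta> * x powr (?e * \<delta>)"
        using B(1) by (simp add: powr_mult powr_powr)
      finally show "\<bar>flux' h x\<bar> powr \<delta> \<le> B powr \<delta> * x powr (?e * \<delta>)" .
    qed simp
  qed
  moreover have "weak_deriv_on 1 \<Omega> v (flux h)"
    by (rule weak_deriv_on_1[OF d1 cf \<Omega>0])
  moreover have "weak_deriv_on 2 \<Omega> v (flux' h)"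
    by (rule weak_deriv_on_2[OF d1 d2 continuous_flux'[OF h] \<Omega>0])
  moreover have "{1..2} = {1, 2::nat}" by auto
  ultimately show ?thesis unfolding sobolev_def by auto
qed

lemma solution_sobolev_loc:
  assumes h: "profile h"
    and d: "\<And>r. r \<ge> 0 \<Longrightarrow> (v has_real_derivative flux h r) (at r within {0..})"
    and \<delta>: "\<delta> > 0" "(\<tau> / \<theta> - q - 1) * \<delta> > - 1"
  shows "sobolev_loc 2 \<delta> {0<..} v"
  unfolding sobolev_loc_def
proof (intro allI impI)
  fix U :: "real set" assume U: "open U \<and> compact (closure U) \<and> closure U \<subseteq> {0<..}"
  then have "bounded U" using bounded_subset[OF compact_imp_bounded closure_subset] by blast
  then obtain b where b: "\<And>x. x \<in> U \<Longrightarrow> \<bar>x\<bar> \<le> b" unfolding bounded_iff by auto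
  have "U \<subseteq> {0<..<\<bar>b\<bar> + 1}"
  proof
    fix x assume "x \<in> U"
    then have "x > 0" "x \<le> b" using U closure_subset[of U] b[of x] by auto
    then show "x \<in> {0<..<\<bar>b\<bar> + 1}" by auto
  qed
  then show "sobolev 2 \<delta> U v"
    using U by (intro solution_sobolev[OF h d _ _ _ \<delta>, where R = "\<bar>b\<bar> + 1"]) auto
qed

section \<open>The integral condition and barriers\<close>

definition g_primitive :: "real \<Rightarrow> real" where
  "g_primitive t = integral {0..t} g"

text \<open>The primitive of the integrand in the Keller-Osserman condition. The base point \<open>t0 / 2\<close> is positive
  and lies below \<open>t0\<close>, which makes the primitive differentiable from both sides at \<open>t0\<close>.\<close>
definition ko_integral :: "real \<Rightarrow> real \<Rightarrow> real" where
  "ko_integral t0 x = integral {t0 / 2..x} (\<lambda>t. g_primitive t powr (- 1 / (\<theta> + 1)))"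

lemma g_integrable: "g integrable_on {a..b}"
  by (rule integrable_continuous_real[OF continuous_on_subset[OF g_cont]]) simp

lemma g_primitive_has_derivative:
  assumes "t > 0"
  shows "(g_primitive has_real_derivative g t) (at t)"
proof -
  have "continuous_on {0..} g" by (rule continuous_on_subset[OF g_cont]) simp
  then have "((\<lambda>x. integral {0..x} g) has_real_derivative g t) (at t within {0..})"
    by (rule integral_has_real_derivative_Ici) (use assms in simp)
  moreover have "g_primitive = (\<lambda>x. integral {0..x} g)" by (auto simp: g_primitive_def)
  ultimately show ?thesis using at_within_Ici_interior[OF assms] by simp
qed

lemma g_primitive_mono: "mono g_primitive"
proof
  fix x y :: real assume "x \<le> y"
  then show "g_primitive x \<le> g_primitive y"
    unfolding g_primitive_def using g_pos
    by (intro integral_subset_le g_integrable) (auto intro: less_imp_le)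
qed

lemma g_primitive_pos:
  assumes "t > 0"
  shows "g_primitive t > 0"
proof -
  have "((\<lambda>_. g 0) has_integral (t - 0) *\<^sub>R g 0) {0..t}"
    using has_integral_const_real[of "g 0" 0 t] assms by simp
  moreover have "(g has_integral g_primitive t) {0..t}"
    unfolding g_primitive_def by (rule integrable_integral[OF g_integrable])
  ultimately have "(t - 0) *\<^sub>R g 0 \<le> g_primitive t"
    by (rule has_integral_le) (use g_mono in \<open>auto simp: mono_def\<close>)
  moreover have "t * g 0 > 0" using assms g_pos[of 0] by simp
  ultimately show ?thesis by simp
qed

lemma g_primitive_powr_has_derivative:
  assumes "t > 0"
  shows "((\<lambda>t. g_primitive t powr p) has_real_derivative p * g_primitive t powr (p - 1) * g t) (at t)"
  using DERIV_chain2[OF has_real_derivative_powr[OF g_primitive_pos[OF assms], of p] g_primitive_has_derivative[OF assms]]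
  by simp

lemma ko_integral_has_derivative:
  assumes t0: "t0 > 0" and x: "x > t0 / 2"
  shows "(ko_integral t0 has_real_derivative g_primitive x powr (- 1 / (\<theta> + 1))) (at x)"
proof -
  let ?k = "\<lambda>t. g_primitive t powr (- 1 / (\<theta> + 1))"
  have "continuous_on {t0 / 2..x + 1} ?k"
    by (intro continuous_at_imp_continuous_on ballI DERIV_isCont[OF g_primitive_powr_has_derivative])
      (use t0 in auto)
  then have "((\<lambda>y. integral {t0 / 2..y} ?k) has_real_derivative ?k x) (at x within {t0 / 2..x + 1})"
    by (rule integral_has_real_derivative) (use x in auto)
  moreover have "at x within {t0 / 2..x + 1} = at x"
    by (rule at_within_interior) (use x in simp)
  moreover have "ko_integral t0 = (\<lambda>y. integral {t0 / 2..y} ?k)" by (auto simp: ko_integral_def)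
  ultimately show ?thesis by simp
qed

lemma ko_integral_strict_mono:
  assumes t0: "t0 > 0" and x: "t0 / 2 < x" "x < y"
  shows "ko_integral t0 x < ko_integral t0 y"
proof (rule DERIV_pos_imp_increasing[OF x(2)])
  fix z assume "x \<le> z" "z \<le> y"
  then show "\<exists>D. (ko_integral t0 has_real_derivative D) (at z) \<and> 0 < D"
    using ko_integral_has_derivative[OF t0, of z] g_primitive_pos[of z] x t0
    by (intro exI[of _ "g_primitive z powr (- 1 / (\<theta> + 1))"] conjI) auto
qed

text \<open>The primitive is increasing. If it is bounded, it has a finite limit and the integral is the
  increment up to that limit; if not, its increments are arbitrarily large lower bounds of the integral.\<close>
lemma nn_integral_infinite_iff:
  assumes t0: "t0 > 0"
  shows "(\<integral>\<^sup>+ t\<in>{t0..}. ennreal ((integral {0..t} g) powr (- 1 / (\<theta> + 1))) \<partial>lborel) = \<infinity>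
    \<longleftrightarrow> (\<forall>B. \<exists>x\<ge>t0. ko_integral t0 x > B)"
proof -
  let ?k = "\<lambda>t. g_primitive t powr (- 1 / (\<theta> + 1))"
  have m: "?k \<in> borel_measurable borel"
    using borel_measurable_mono[OF g_primitive_mono] by measurable
  have d: "(ko_integral t0 has_real_derivative ?k x) (at x)" if "t0 \<le> x" for x
    by (rule ko_integral_has_derivative[OF t0]) (use that t0 in simp)
  let ?I = "\<integral>\<^sup>+ t. ennreal (?k t) * indicator {t0..} t \<partial>lborel"
  have fin: "?I \<noteq> \<infinity>" if bd: "\<forall>x\<ge>t0. ko_integral t0 x \<le> B" for B
  proof -
    have le: "ko_integral t0 x \<le> ko_integral t0 y" if "t0 \<le> x" "x \<le> y" for x y
      using ko_integral_strict_mono[OF t0, of x y] that t0 by (cases "x = y") auto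
    define T where "T = (SUP x\<in>{t0..}. ko_integral t0 x)"
    have bdd: "bdd_above (ko_integral t0 ` {t0..})" using bd by (auto intro: bdd_aboveI)
    have "(ko_integral t0 \<longlongrightarrow> T) at_top"
    proof (rule order_tendstoI)
      fix c assume "c < T"
      then obtain x where x: "x \<ge> t0" "c < ko_integral t0 x"
        unfolding T_def using less_cSUP_iff[OF _ bdd, of c] by auto
      then have "c < ko_integral t0 y" if "y \<ge> x" for y using le[of x y] that by simp
      then show "\<forall>\<^sub>F y in at_top. c < ko_integral t0 y" unfolding eventually_at_top_linorder by blast
    next
      fix c assume c: "T < c"
      have "ko_integral t0 y < c" if "y \<ge> t0" for y
        using cSUP_upper[OF _ bdd, of y] that c unfolding T_def by simp
      then show "\<forall>\<^sub>F y in at_top. ko_integral t0 y < c" unfolding eventually_at_top_linorder by blast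
    qed
    then have "?I = ennreal (T - ko_integral t0 t0)"
      by (intro nn_integral_FTC_atLeast[OF m d]) auto
    then show ?thesis by simp
  qed
  have unb: "?I = \<infinity>" if un: "\<forall>B. \<exists>x\<ge>t0. ko_integral t0 x > B"
  proof (rule ccontr)
    assume "?I \<noteq> \<infinity>"
    then obtain c where c: "c \<ge> 0" "?I = ennreal c" by (cases ?I) auto
    obtain x where x: "x \<ge> t0" "ko_integral t0 x > c + ko_integral t0 t0" using un by blast
    have "ennreal (ko_integral t0 x - ko_integral t0 t0) = (\<integral>\<^sup>+ t. ennreal (?k t) * indicator {t0..x} t \<partial>lborel)"
      by (rule nn_integral_FTC_Icc[symmetric, OF m d]) (use x in auto)
    also have "\<dots> \<le> ?I"
      by (intro nn_integral_mono) (auto split: split_indicator)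
    also have "\<dots> = ennreal c" using c by simp
    finally show False using x c by (subst (asm) ennreal_le_iff) auto
  qed
  have "?I = \<infinity> \<longleftrightarrow> (\<forall>B. \<exists>x\<ge>t0. ko_integral t0 x > B)"
    using fin unb by (meson not_le)
  then show ?thesis by (simp add: g_primitive_def)
qed

text \<open>The barrier solves \<open>w' = c * g_primitive w powr (1 / (\<theta> + 1))\<close>. By separation of variables \<open>w\<close> is the
  inverse of \<open>ko_integral t0\<close> after an affine substitution, and it exists for all times exactly because
  \<open>ko_integral t0\<close> is unbounded. Differentiating \<open>w' powr \<theta>\<close> gives a multiple of \<open>g w\<close>. Starting at a
  point \<open>b \<ge> t0 > 0\<close> keeps \<open>g_primitive w\<close> positive, so the equation is nowhere singular.\<close>
lemma barrier_exists:
  assumes t0: "t0 > 0" and un: "\<forall>B. \<exists>x\<ge>t0. ko_integral t0 x > B" and K: "K > 0"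
  obtains w w' where
    "\<And>r. r \<ge> 0 \<Longrightarrow> (w has_real_derivative w' r) (at r)"
    "continuous_on {0..} w'" "\<And>r. r \<ge> 0 \<Longrightarrow> w' r \<ge> 0" "w 0 \<ge> a"
    "\<And>r. r \<ge> 0 \<Longrightarrow> K * integral {0..r} (\<lambda>s. g (w s)) \<le> w' r powr \<theta>"
proof -
  define S where "S = {t0 / 2<..}"
  define b where "b = max a t0"
  \<comment> \<open>This constant makes the derivative of \<open>w' powr \<theta>\<close> equal to \<open>K * g w\<close>.\<close>
  define c where "c = (K * (\<theta> + 1) / \<theta>) powr (1 / (\<theta> + 1))"
  define y0 where "y0 = ko_integral t0 b"
  define J where "J = inv_into S (ko_integral t0)"
  define w where "w r = J (y0 + c * r)" for r
  define w' where "w' r = c * g_primitive (w r) powr (1 / (\<theta> + 1))" for r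
  have c: "c > 0" using K \<theta> by (simp add: c_def)
  have b: "b \<ge> t0" "b \<ge> a" "b > 0" by (simp_all add: b_def t0 less_max_iff_disj)
  have inj: "inj_on (ko_integral t0) S"
    using ko_integral_strict_mono[OF t0] unfolding S_def by (intro linorder_inj_onI) (auto simp: less_imp_neq)
  have Hd: "(ko_integral t0 has_real_derivative g_primitive x powr (- 1 / (\<theta> + 1))) (at x)" if "x \<in> S" for x
    using ko_integral_has_derivative[OF t0, of x] that by (simp add: S_def)
  have Hc: "continuous_on S (ko_integral t0)"
    by (intro continuous_at_imp_continuous_on ballI DERIV_isCont[OF Hd])
  have J: "J (ko_integral t0 x) = x" if "x \<in> S" for x
    unfolding J_def using inv_into_f_f[OF inj that] .
  have surj: "\<exists>x\<ge>b. ko_integral t0 x = y" if "y \<ge> y0" for y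
  proof -
    obtain X where X: "X \<ge> t0" "ko_integral t0 X > y" using un by blast
    have Xb: "b \<le> X"
    proof (rule ccontr)
      assume "\<not> b \<le> X"
      then have "ko_integral t0 X < ko_integral t0 b" using X t0 by (intro ko_integral_strict_mono[OF t0]) auto
      with X that show False by (simp add: y0_def)
    qed
    have "continuous_on {b..X} (ko_integral t0)"
      using Hc by (rule continuous_on_subset) (use b t0 in \<open>auto simp: S_def\<close>)
    then show ?thesis
      using IVT'[of "ko_integral t0" b y X] X Xb that by (auto simp: y0_def)
  qed
  have w: "w r \<ge> b" "ko_integral t0 (w r) = y0 + c * r" if "r \<ge> 0" for r
  proof -
    have "y0 + c * r \<ge> y0" using that c by simp
    then obtain x where x: "x \<ge> b" "ko_integral t0 x = y0 + c * r" using surj by blast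
    then have "x \<in> S" using b t0 by (simp add: S_def)
    then have "w r = x" using J x by (metis w_def)
    then show "w r \<ge> b" "ko_integral t0 (w r) = y0 + c * r" using x by auto
  qed
  have wS: "w r \<in> S" "w r > 0" if "r \<ge> 0" for r
    using w(1)[OF that] b t0 by (auto simp: S_def)
  have wd: "(w has_real_derivative w' r) (at r)" if r: "r \<ge> 0" for r
  proof -
    let ?D = "g_primitive (w r) powr (- 1 / (\<theta> + 1))"
    have D: "?D > 0" using g_primitive_pos[OF wS(2)[OF r]] by simp
    have "(J has_derivative (*) (inverse ?D)) (at (ko_integral t0 (w r)))"
    proof (rule has_derivative_inverse_strong[of S "w r" "ko_integral t0" J "(*) ?D"])
      show "(ko_integral t0 has_derivative (*) ?D) (at (w r))"
        using Hd[OF wS(1)[OF r]] by (simp add: has_field_derivative_def)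
      show "(*) ?D \<circ> (*) (inverse ?D) = id" using D by (auto simp: fun_eq_iff)
    qed (use wS(1)[OF r] Hc J in \<open>auto simp: S_def\<close>)
    then have "(J has_real_derivative inverse ?D) (at (y0 + c * r))"
      using w(2)[OF r] by (simp add: has_field_derivative_def)
    moreover have "((\<lambda>r. y0 + c * r) has_real_derivative c) (at r)"
      by (auto intro!: derivative_eq_intros)
    ultimately have "((\<lambda>r. J (y0 + c * r)) has_real_derivative inverse ?D * c) (at r)"
      by (rule DERIV_chain2)
    moreover have "inverse ?D * c = w' r"
      unfolding w'_def using powr_minus[of "g_primitive (w r)" "1 / (\<theta> + 1)"] by (simp add: mult.commute)
    moreover have "w = (\<lambda>r. J (y0 + c * r))" by (auto simp: w_def)
    ultimately show ?thesis by simp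
  qed
  have wc: "continuous_on {0..} w"
    by (intro continuous_at_imp_continuous_on ballI DERIV_isCont[OF wd]) simp
  have w'_nonneg: "w' r \<ge> 0" for r using c by (simp add: w'_def)
  have w'c: "continuous_on {0..} w'"
  proof -
    have "isCont w' r" if "r \<ge> 0" for r
      using DERIV_isCont[OF DERIV_chain2[OF g_primitive_powr_has_derivative[OF wS(2)[OF that]] wd[OF that]]]
      unfolding w'_def by (intro continuous_mult continuous_const)
    then show ?thesis by (intro continuous_at_imp_continuous_on) auto
  qed
  have energy: "((\<lambda>r. w' r powr \<theta>) has_real_derivative K * g (w r)) (at r)" if r: "r \<ge> 0" for r
  proof -
    have eq: "w' x powr \<theta> = c powr \<theta> * g_primitive (w x) powr (\<theta> / (\<theta> + 1))" for x
      using c by (simp add: w'_def powr_mult powr_powr)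
    let ?u = "g_primitive (w r)"
    have u: "?u > 0" using g_primitive_pos[OF wS(2)[OF r]] .
    have "((\<lambda>x. c powr \<theta> * g_primitive (w x) powr (\<theta> / (\<theta> + 1))) has_real_derivative
       c powr \<theta> * (\<theta> / (\<theta> + 1) * ?u powr (\<theta> / (\<theta> + 1) - 1) * g (w r) * w' r)) (at r)"
      by (rule DERIV_cmult[OF DERIV_chain2[OF g_primitive_powr_has_derivative[OF wS(2)[OF r]] wd[OF r]]])
    moreover have "c powr \<theta> * (\<theta> / (\<theta> + 1) * ?u powr (\<theta> / (\<theta> + 1) - 1) * g (w r) * w' r) = K * g (w r)"
    proof -
      have "\<theta> / (\<theta> + 1) - 1 + 1 / (\<theta> + 1) = 0" using \<theta> by (simp add: field_simps)
      then have 1: "?u powr (\<theta> / (\<theta> + 1) - 1) * ?u powr (1 / (\<theta> + 1)) = 1"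
        unfolding powr_add[symmetric] using u by simp
      have "c powr \<theta> * c = c powr (\<theta> + 1)" using c by (simp add: powr_add)
      also have "\<dots> = K * (\<theta> + 1) / \<theta>"
        unfolding c_def using K \<theta> by (simp add: powr_powr)
      finally have 2: "c powr \<theta> * c * (\<theta> / (\<theta> + 1)) = K" using \<theta> by simp
      have "c powr \<theta> * (\<theta> / (\<theta> + 1) * ?u powr (\<theta> / (\<theta> + 1) - 1) * g (w r) * w' r)
         = (c powr \<theta> * c * (\<theta> / (\<theta> + 1))) * (?u powr (\<theta> / (\<theta> + 1) - 1) * ?u powr (1 / (\<theta> + 1))) * g (w r)"
        unfolding w'_def by (simp only: mult_ac)
      then show ?thesis unfolding 1 2 by simp
    qed
    ultimately show ?thesis unfolding eq by simp
  qed
  have "K * integral {0..r} (\<lambda>s. g (w s)) \<le> w' r powr \<theta>" if r: "r \<ge> 0" for r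
  proof -
    have "((\<lambda>s. K * g (w s)) has_integral w' r powr \<theta> - w' 0 powr \<theta>) {0..r}"
    proof (rule fundamental_theorem_of_calculus[OF r])
      fix x assume "x \<in> {0..r}"
      then show "((\<lambda>r. w' r powr \<theta>) has_vector_derivative K * g (w x)) (at x within {0..r})"
        using energy[of x] unfolding has_real_derivative_iff_has_vector_derivative
        by (auto intro: has_vector_derivative_at_within)
    qed
    then have "integral {0..r} (\<lambda>s. K * g (w s)) = w' r powr \<theta> - w' 0 powr \<theta>"
      by (rule integral_unique)
    then show ?thesis by simp
  qed
  moreover have "w 0 \<ge> a" using w(1)[of 0] b by simp
  ultimately show ?thesis using that[of w w'] wd w'c w'_nonneg by blast
qed

section \<open>Existence by monotone iteration\<close>

primrec iterate :: "real \<Rightarrow> nat \<Rightarrow> real \<Rightarrow> real" where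
  "iterate a 0 = (\<lambda>_. a)"
| "iterate a (Suc n) = (\<lambda>r. a + integral {0..r} (flux (\<lambda>s. g (iterate a n s))))"

lemma flux_integrable: "profile h \<Longrightarrow> flux h integrable_on {0..r}"
  by (rule integrable_continuous_real[OF continuous_on_subset[OF continuous_flux]]) auto

lemma iterate_continuous_mono: "continuous_on {0..} (iterate a n) \<and> mono_on {0..} (iterate a n)"
proof (induction n)
  case 0
  show ?case by (simp add: mono_on_def)
next
  case (Suc n)
  let ?h = "\<lambda>s. g (iterate a n s)"
  have h: "profile ?h" using Suc.IH by (intro profile_comp) auto
  have "continuous_on {0..} (\<lambda>r. integral {0..r} (flux ?h))"
    by (rule continuous_on_Ici_if_Icc[OF indefinite_integral_continuous_1[OF flux_integrable[OF h]]])
  moreover have "integral {0..r} (flux ?h) \<le> integral {0..s} (flux ?h)" if "r \<le> s" for r s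
    using that flux_nonneg by (intro integral_subset_le flux_integrable h) auto
  ultimately show ?case
    by (auto intro!: continuous_intros simp: mono_on_def)
qed

lemma iterate_profile: "profile (\<lambda>s. g (iterate a n s))"
  using iterate_continuous_mono by (intro profile_comp) auto

lemma iterate_le_Suc: "r \<ge> 0 \<Longrightarrow> iterate a n r \<le> iterate a (Suc n) r"
proof (induction n arbitrary: r)
  case 0
  show ?case
    by (simp, rule integral_nonneg[OF flux_integrable[OF iterate_profile[of a 0, simplified]] flux_nonneg])
next
  case (Suc n)
  have "integral {0..r} (flux (\<lambda>s. g (iterate a n s))) \<le>
      integral {0..r} (flux (\<lambda>s. g (iterate a (Suc n) s)))"
  proof (rule integral_le[OF flux_integrable flux_integrable])
    fix x assume "x \<in> {0..r}"
    show "flux (\<lambda>s. g (iterate a n s)) x \<le> flux (\<lambda>s. g (iterate a (Suc n) s)) x"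
      by (rule flux_mono[OF iterate_profile iterate_profile]) (rule monoD[OF g_mono Suc.IH])
  qed (rule iterate_profile)+
  then show ?case by simp
qed

text \<open>As \<open>\<tau> \<ge> 1\<close>, the weight in the mass is at most \<open>r powr (\<tau> - 1)\<close>. The powers of \<open>r\<close> then combine to
  \<open>r powr (\<tau> - 1 - \<theta> * q)\<close>, whose exponent is nonnegative, so it can be bounded at \<open>R\<close>; what remains is the
  autonomous inequality that a barrier satisfies.\<close>
lemma flux_le_barrier:
  assumes w: "continuous_on {0..} w" "mono_on {0..} w"
    and K: "K = C powr \<theta> * R powr (\<tau> - 1 - \<theta> * q)"
    and bar: "K * integral {0..r} (\<lambda>s. g (w s)) \<le> w' powr \<theta>" "w' \<ge> 0"
    and h: "profile h" "\<And>s. 0 \<le> s \<Longrightarrow> s \<le> r \<Longrightarrow> h s \<le> g (w s)"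
    and r: "0 \<le> r" "r \<le> R"
  shows "flux h r \<le> w'"
proof (cases "r = 0")
  case True
  then show ?thesis using bar by simp
next
  case False
  then have r0: "r > 0" using r by simp
  define I where "I = integral {0..r} (\<lambda>s. g (w s))"
  have gw: "(\<lambda>s. g (w s)) integrable_on {0..r}"
    by (rule integrable_continuous_real[OF continuous_on_subset[OF profileD(1)[OF profile_comp[OF w]]]]) auto
  have I: "I \<ge> 0"
    unfolding I_def by (rule integral_nonneg[OF gw]) (use g_pos in \<open>auto intro: less_imp_le\<close>)
  have "mass h r \<le> integral {0..r} (\<lambda>s. r powr (\<tau> - 1) * g (w s))"
    unfolding mass_def
  proof (rule integral_le[OF profile_integrable[OF h(1)] integrable_on_mult_right[OF gw]])
    fix s assume s: "s \<in> {0..r}"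
    then show "s powr (\<tau> - 1) * h s \<le> r powr (\<tau> - 1) * g (w s)"
      using h(2)[of s] profileD(3)[OF h(1), of s] \<tau>_ge_1
      by (intro mult_mono powr_mono2) auto
  qed
  then have m: "mass h r \<le> r powr (\<tau> - 1) * I" by (simp add: I_def)
  have "C powr \<theta> * r powr (- q * \<theta>) * mass h r \<le> C powr \<theta> * r powr (- q * \<theta>) * (r powr (\<tau> - 1) * I)"
    by (rule mult_left_mono[OF m]) simp
  also have "\<dots> = C powr \<theta> * r powr (\<tau> - 1 - \<theta> * q) * I"
  proof -
    have "r powr (- q * \<theta>) * r powr (\<tau> - 1) = r powr (\<tau> - 1 - \<theta> * q)"
      unfolding powr_add[symmetric] by (simp add: mult.commute)
    then show ?thesis by (simp add: mult.assoc)
  qed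
  also have "\<dots> \<le> K * I"
    unfolding K using r0 r \<tau> I by (intro mult_right_mono mult_left_mono powr_mono2) auto
  also have "\<dots> \<le> w' powr \<theta>" using bar(1) by (simp add: I_def)
  finally have le: "C powr \<theta> * r powr (- q * \<theta>) * mass h r \<le> w' powr \<theta>" .
  have "flux h r = (C powr \<theta> * r powr (- q * \<theta>) * mass h r) powr (1 / \<theta>)"
    unfolding flux_def using C \<theta> mass_nonneg[OF h(1)] by (simp add: powr_mult powr_powr)
  also have "\<dots> \<le> (w' powr \<theta>) powr (1 / \<theta>)"
    using le \<theta> mass_nonneg[OF h(1)] by (intro powr_mono2) auto
  also have "\<dots> = w'" using \<theta> bar(2) by (simp add: powr_powr)
  finally show ?thesis .
qed

text \<open>By induction all iterates stay below one barrier on \<open>{0..R}\<close>. The barrier depends on \<open>R\<close>, which does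
  no harm since only pointwise bounds are wanted.\<close>
lemma iterate_bounded:
  assumes t0: "t0 > 0" and un: "\<forall>B. \<exists>x\<ge>t0. ko_integral t0 x > B" and R: "R > 0"
  obtains B where "\<And>n. iterate a n R \<le> B"
proof -
  define K where "K = C powr \<theta> * R powr (\<tau> - 1 - \<theta> * q)"
  have "K > 0" using C R by (simp add: K_def)
  then obtain w w' where w: "\<And>r. r \<ge> 0 \<Longrightarrow> (w has_real_derivative w' r) (at r)"
    "continuous_on {0..} w'" "\<And>r. r \<ge> 0 \<Longrightarrow> w' r \<ge> 0" "w 0 \<ge> a"
    "\<And>r. r \<ge> 0 \<Longrightarrow> K * integral {0..r} (\<lambda>s. g (w s)) \<le> w' r powr \<theta>"
    using barrier_exists[OF t0 un] by metis
  have wc: "continuous_on {0..} w"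
    by (intro continuous_at_imp_continuous_on ballI DERIV_isCont[OF w(1)]) simp
  have wle: "w x \<le> w y" if "0 \<le> x" "x \<le> y" for x y
  proof (rule DERIV_nonneg_imp_nondecreasing[OF that(2)])
    fix r assume "x \<le> r"
    then show "\<exists>D. (w has_real_derivative D) (at r) \<and> 0 \<le> D"
      using that w(1)[of r] w(3)[of r] by auto
  qed
  then have wm: "mono_on {0..} w" by (auto simp: mono_on_def)
  have "\<forall>r. 0 \<le> r \<and> r \<le> R \<longrightarrow> iterate a n r \<le> w r" for n
  proof (induction n)
    case 0
    show ?case using w(4) wle[of 0] by fastforce
  next
    case (Suc n)
    show ?case
    proof (intro allI impI)
      fix r assume r: "0 \<le> r \<and> r \<le> R"
      have "(w' has_integral w r - w 0) {0..r}"
      proof (rule fundamental_theorem_of_calculus)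
        fix x assume "x \<in> {0..r}"
        then show "(w has_vector_derivative w' x) (at x within {0..r})"
          using w(1)[of x] unfolding has_real_derivative_iff_has_vector_derivative
          by (auto intro: has_vector_derivative_at_within)
      qed (use r in simp)
      then have "integral {0..r} (flux (\<lambda>s. g (iterate a n s))) \<le> w r - w 0"
      proof (rule has_integral_le[OF integrable_integral[OF flux_integrable[OF iterate_profile]]])
        fix x assume x: "x \<in> {0..r}"
        show "flux (\<lambda>s. g (iterate a n s)) x \<le> w' x"
        proof (rule flux_le_barrier[OF wc wm K_def w(5) w(3) iterate_profile])
          fix s assume "0 \<le> s" "s \<le> x"
          then have "iterate a n s \<le> w s" using Suc.IH x r by auto
          then show "g (iterate a n s) \<le> g (w s)" by (rule monoD[OF g_mono])
        qed (use x r in auto)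
      qed
      then show "iterate a (Suc n) r \<le> w r" using w(4) by simp
    qed
  qed
  then have "iterate a n R \<le> w R" for n using R by auto
  then show ?thesis by (rule that)
qed

text \<open>The limit \<open>k\<close> need not be a profile: the limit of the iterates is not yet known to be continuous when
  this is applied.\<close>
lemma flux_tendsto_pointwise:
  assumes h: "\<And>n. profile (h n)" and h': "\<And>s. 0 \<le> s \<Longrightarrow> (\<lambda>n. h n s) \<longlonglongrightarrow> k s"
    and M: "\<And>n s. 0 \<le> s \<Longrightarrow> s \<le> r \<Longrightarrow> h n s \<le> M"
  shows "(\<lambda>n. flux (h n) r) \<longlonglongrightarrow> flux k r"
proof -
  have "(\<lambda>n. integral {0..r} (\<lambda>s. s powr (\<tau> - 1) * h n s)) \<longlonglongrightarrow> integral {0..r} (\<lambda>s. s powr (\<tau> - 1) * k s)"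
  proof (rule dominated_convergence(2))
    show "(\<lambda>s. s powr (\<tau> - 1) * M) integrable_on {0..r}"
      by (rule integrand_integrable) simp
    fix n s assume s: "s \<in> {0..r}"
    then have "0 < h n s" "h n s \<le> M" using profileD(3)[OF h] M by auto
    then show "norm (s powr (\<tau> - 1) * h n s) \<le> s powr (\<tau> - 1) * M"
      by (simp add: abs_mult mult_left_mono)
  qed (use h h' profile_integrable in \<open>auto intro!: tendsto_intros\<close>)
  then have "(\<lambda>n. mass (h n) r) \<longlonglongrightarrow> mass k r" by (simp add: mass_def)
  then have "(\<lambda>n. mass (h n) r powr (1 / \<theta>)) \<longlonglongrightarrow> mass k r powr (1 / \<theta>)"
    using \<theta> mass_nonneg[OF h] by (intro tendsto_powr' tendsto_const) auto
  then show ?thesis unfolding flux_def by (rule tendsto_mult[OF tendsto_const])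
qed

text \<open>The iterates increase and are bounded, so they converge to some \<open>v\<close>. Their values on \<open>{0..R}\<close> are at
  most \<open>v R\<close>, hence the flux of the constant \<open>g (v R)\<close> dominates all their fluxes, and \<open>v\<close> satisfies the
  integral equation. That equation then yields the continuity and the derivative of \<open>v\<close>.\<close>
proposition convex_solution_exists:
  assumes t0: "t0 > 0" and un: "\<forall>B. \<exists>x\<ge>t0. ko_integral t0 x > B"
  shows "\<exists>v. convex_solution g q \<theta> C \<tau> a v"
proof -
  define v where "v r = lim (\<lambda>n. iterate a n r)" for r
  let ?h = "\<lambda>s. g (v s)"
  have inc: "incseq (\<lambda>n. iterate a n r)" if "r \<ge> 0" for r
    using iterate_le_Suc[OF that] by (rule incseq_SucI)
  have im: "iterate a n r \<le> iterate a n s" if "0 \<le> r" "r \<le> s" for n r s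
    by (rule mono_onD[of "{0..}"]) (use iterate_continuous_mono[of a n] that in auto)
  have conv: "(\<lambda>n. iterate a n r) \<longlonglongrightarrow> v r" if r: "r \<ge> 0" for r
  proof -
    obtain B where B: "\<And>n. iterate a n (r + 1) \<le> B"
      using iterate_bounded[OF t0 un, of "r + 1" a] r by auto
    have "iterate a n r \<le> B" for n using im[of r "r + 1" n] B[of n] r by simp
    then obtain L where "(\<lambda>n. iterate a n r) \<longlonglongrightarrow> L"
      using incseq_convergent[OF inc[OF r], of B] by blast
    then show ?thesis unfolding v_def by (simp add: limI)
  qed
  have le_v: "iterate a n r \<le> v r" if "r \<ge> 0" for n r
    by (rule incseq_le[OF inc[OF that] conv[OF that]])
  have vm: "v r \<le> v s" if "0 \<le> r" "r \<le> s" for r s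
    by (rule LIMSEQ_le[OF conv conv]) (use that im in auto)
  have gconv: "(\<lambda>n. g (iterate a n s)) \<longlonglongrightarrow> g (v s)" if "0 \<le> s" for s
  proof -
    have "isCont g (v s)" using g_cont by (simp add: continuous_on_eq_continuous_at)
    then show ?thesis by (rule isCont_tendsto_compose[OF _ conv[OF that]])
  qed
  have dom: "g (iterate a n s) \<le> g (v R)" if "0 \<le> s" "s \<le> R" for n s R
    by (rule monoD[OF g_mono]) (use le_v[of s n] vm[of s R] that in auto)
  have lim: "flux ?h integrable_on {0..R}" "v R = a + integral {0..R} (flux ?h)" if R: "R \<ge> 0" for R
  proof -
    have const: "profile (\<lambda>_. g (v R))" by (simp add: profile_def mono_on_def g_pos)
    have bound: "norm (flux (\<lambda>s. g (iterate a n s)) r) \<le> flux (\<lambda>_. g (v R)) r" if r: "r \<in> {0..R}" for n r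
    proof -
      have "flux (\<lambda>s. g (iterate a n s)) r \<le> flux (\<lambda>_. g (v R)) r"
        by (rule flux_mono[OF iterate_profile const]) (use r dom in auto)
      then show ?thesis using flux_nonneg by simp
    qed
    have fl: "(\<lambda>n. flux (\<lambda>s. g (iterate a n s)) r) \<longlonglongrightarrow> flux ?h r" for r
      by (rule flux_tendsto_pointwise[OF iterate_profile gconv dom])
    note dc = dominated_convergence[OF flux_integrable[OF iterate_profile] flux_integrable[OF const] bound fl]
    show "flux ?h integrable_on {0..R}" by (rule dc(1))
    have "(\<lambda>n. a + integral {0..R} (flux (\<lambda>s. g (iterate a n s)))) \<longlonglongrightarrow> a + integral {0..R} (flux ?h)"
      by (intro tendsto_intros dc(2))
    then have "(\<lambda>n. iterate a (Suc n) R) \<longlonglongrightarrow> a + integral {0..R} (flux ?h)" by simp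
    then show "v R = a + integral {0..R} (flux ?h)"
      using LIMSEQ_Suc[OF conv[OF R]] LIMSEQ_unique by blast
  qed
  have cI: "continuous_on {0..} (\<lambda>r. a + integral {0..r} (flux ?h))"
    by (intro continuous_intros continuous_on_Ici_if_Icc indefinite_integral_continuous_1 lim(1)) simp
  have vc: "continuous_on {0..} v"
    by (rule continuous_on_eq[OF cI]) (use lim(2) in auto)
  have h: "profile ?h"
    using vm by (intro profile_comp vc) (auto simp: mono_on_def)
  have "(v has_real_derivative flux ?h r) (at r within {0..})" if r: "r \<ge> 0" for r
  proof (rule has_real_derivative_on_cong)
    show "((\<lambda>r. a + integral {0..r} (flux ?h)) has_real_derivative flux ?h r) (at r within {0..})"
      using DERIV_add[OF DERIV_const integral_has_real_derivative_Ici[OF continuous_flux[OF h] r], of a]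
      by simp
  qed (use lim(2) r in auto)
  moreover have "v 0 = a" using lim(2)[of 0] by simp
  ultimately have "convex_solution g q \<theta> C \<tau> a v" using h by (intro convex_solutionI)
  then show ?thesis by blast
qed

section \<open>Necessity of the integral condition\<close>

text \<open>In this product the powers of the mass cancel. By \<open>bracket_ge\<close> the remaining power of \<open>r\<close> has exponent
  \<open>\<tau> - 1 - \<theta> * q \<ge> 0\<close>, so it is at least \<open>1\<close> for \<open>r \<ge> 1\<close>.\<close>
lemma flux'_lower_bound:
  assumes h: "profile h" and r: "r \<ge> 1"
  shows "C powr \<theta> * (1 / \<theta> - q / \<tau>) * h r \<le> flux h r powr (\<theta> - 1) * flux' h r"
proof -
  have r0: "r > 0" using r by simp
  define m where "m = mass h r"
  define b where "b = r powr \<tau> * h r / \<theta> - q * m"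
  have m: "m > 0" unfolding m_def by (rule mass_pos[OF h r0])
  have "flux h r powr (\<theta> - 1) = C powr (\<theta> - 1) * r powr (- q * (\<theta> - 1)) * m powr (1 / \<theta> * (\<theta> - 1))"
    unfolding flux_def m_def[symmetric] using C by (simp add: powr_mult powr_powr)
  then have "flux h r powr (\<theta> - 1) * flux' h r = (C powr (\<theta> - 1) * C) *
     (r powr (- q * (\<theta> - 1)) * r powr (- q - 1)) *
     (m powr (1 / \<theta> * (\<theta> - 1)) * m powr (1 / \<theta> - 1)) * b"
    unfolding flux'_def m_def[symmetric] b_def by (simp only: mult_ac)
  also have "C powr (\<theta> - 1) * C = C powr \<theta>" using C by (simp add: powr_diff)
  also have "r powr (- q * (\<theta> - 1)) * r powr (- q - 1) = r powr (- q * \<theta> - 1)"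
    unfolding powr_add[symmetric] by (rule arg_cong[of _ _ "(powr) r"]) (simp add: algebra_simps)
  also have "m powr (1 / \<theta> * (\<theta> - 1)) * m powr (1 / \<theta> - 1) = 1"
  proof -
    have "1 / \<theta> * (\<theta> - 1) + (1 / \<theta> - 1) = 0" using \<theta> by (simp add: field_simps)
    then show ?thesis unfolding powr_add[symmetric] using m by simp
  qed
  finally have eq: "flux h r powr (\<theta> - 1) * flux' h r = C powr \<theta> * r powr (- q * \<theta> - 1) * b" by simp
  have "1 \<le> r powr (\<tau> - 1 - \<theta> * q)" using r \<tau> by (intro ge_one_powr_ge_zero) auto
  then have "C powr \<theta> * (1 / \<theta> - q / \<tau>) * h r * 1 \<le>
      C powr \<theta> * (1 / \<theta> - q / \<tau>) * h r * r powr (\<tau> - 1 - \<theta> * q)"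
    using bracket_factor_pos profileD(3)[OF h, of r] r0 by (intro mult_left_mono) auto
  also have "r powr (\<tau> - 1 - \<theta> * q) = r powr (- q * \<theta> - 1) * r powr \<tau>"
    unfolding powr_add[symmetric] by (rule arg_cong[of _ _ "(powr) r"]) (simp add: algebra_simps)
  also have "C powr \<theta> * (1 / \<theta> - q / \<tau>) * h r * (r powr (- q * \<theta> - 1) * r powr \<tau>) =
      C powr \<theta> * r powr (- q * \<theta> - 1) * (r powr \<tau> * h r * (1 / \<theta> - q / \<tau>))"
    by (simp only: mult_ac)
  also have "\<dots> \<le> C powr \<theta> * r powr (- q * \<theta> - 1) * b"
    unfolding b_def m_def by (intro mult_left_mono bracket_ge[OF h r0]) simp
  finally show ?thesis unfolding eq by simp
qed

text \<open>Write \<open>p = v'\<close>. Multiplying \<open>flux'_lower_bound\<close> by \<open>p\<close> and integrating gives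
  \<open>p powr (\<theta> + 1) \<ge> \<kappa> * g_primitive v\<close> far out. So \<open>ko_integral t0\<close> has, along \<open>v\<close>, a derivative bounded
  below by a positive constant, and \<open>v\<close> exists for all times.\<close>
proposition convex_solution_imp_unbounded:
  assumes v: "convex_solution g q \<theta> C \<tau> a v" and t0: "t0 > 0"
  shows "\<forall>B. \<exists>x\<ge>t0. ko_integral t0 x > B"
proof
  fix B
  let ?h = "\<lambda>s. g (v s)"
  note prof = convex_solution_profile[OF v]
  define p where "p = flux ?h"
  define c where "c = C powr \<theta> * (1 / \<theta> - q / \<tau>)"
  have c: "c > 0" unfolding c_def using C bracket_factor_pos by simp
  have vd: "(v has_real_derivative p r) (at r)" if "r > 0" for r
    using prof(3)[of r] that at_within_Ici_interior[OF that] by (simp add: p_def)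
  have pd: "(p has_real_derivative flux' ?h r) (at r)" if "r > 0" for r
    unfolding p_def by (rule flux_has_derivative[OF prof(2) that])
  have pp: "p r > 0" if "r > 0" for r
    unfolding p_def by (rule flux_pos[OF prof(2) that])
  have v_mono: "v x \<le> v y" if "0 < x" "x \<le> y" for x y :: real
  proof (rule DERIV_nonneg_imp_nondecreasing[OF that(2)])
    fix r assume "x \<le> r"
    then show "\<exists>D. (v has_real_derivative D) (at r) \<and> 0 \<le> D"
      using that vd[of r] pp[of r] by (intro exI[of _ "p r"]) simp
  qed
  have p_mono: "p x \<le> p y" if "0 < x" "x \<le> y" for x y :: real
  proof (rule DERIV_nonneg_imp_nondecreasing[OF that(2)])
    fix r assume "x \<le> r"
    then show "\<exists>D. (p has_real_derivative D) (at r) \<and> 0 \<le> D"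
      using that pd[of r] flux'_pos[OF prof(2), of r] by (intro exI[of _ "flux' ?h r"]) simp
  qed
  have v1: "v 1 \<ge> a"
  proof -
    have cv: "continuous_on {0..1} v"
      using prof(3) differentiable_onI_real[of "{0..}" v p]
      by (auto simp: p_def intro: continuous_on_subset[OF differentiable_imp_continuous_on])
    have "v 0 \<le> v 1"
    proof (rule DERIV_nonneg_imp_increasing_open[OF _ _ cv])
      fix r :: real assume "0 < r"
      then show "\<exists>D. (v has_real_derivative D) (at r) \<and> 0 \<le> D"
        using vd[of r] pp[of r] by (intro exI[of _ "p r"]) simp
    qed simp
    then show ?thesis using prof(1) by simp
  qed
  have linear: "v 1 + p 1 * (r - 1) \<le> v r" if r: "r \<ge> 1" for r
  proof -
    have "v 1 - p 1 * 1 \<le> v r - p 1 * r"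
    proof (rule DERIV_nonneg_imp_nondecreasing[OF r])
      fix x :: real assume "1 \<le> x"
      then have "((\<lambda>r. v r - p 1 * r) has_real_derivative p x - p 1) (at x)" "0 \<le> p x - p 1"
        using p_mono[of 1 x] DERIV_diff[OF vd[of x] DERIV_cmult_Id[of "p 1" x UNIV]] by auto
      then show "\<exists>D. ((\<lambda>r. v r - p 1 * r) has_real_derivative D) (at x) \<and> 0 \<le> D" by blast
    qed
    then show ?thesis by (simp add: algebra_simps)
  qed
  \<comment> \<open>By the linear lower bound, \<open>v\<close> has reached \<open>t0\<close> at this point.\<close>
  define r1 where "r1 = 1 + (t0 + \<bar>a\<bar>) / p 1"
  have r1: "r1 \<ge> 1" using pp[of 1] t0 by (simp add: r1_def)
  have vr1: "v r1 \<ge> t0"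
  proof -
    have "p 1 * (r1 - 1) = t0 + \<bar>a\<bar>" using pp[of 1] by (simp add: r1_def)
    then show ?thesis using linear[OF r1] v1 by linarith
  qed
  have vt: "v r \<ge> t0" "v r > 0" if "r \<ge> r1" for r
    using v_mono[of r1 r] vr1 that r1 t0 by auto
  \<comment> \<open>The constant makes the energy inequality hold at the initial point \<open>r1\<close>.\<close>
  define \<kappa> where "\<kappa> = min (c * (\<theta> + 1)) (p r1 powr (\<theta> + 1) / g_primitive (v r1))"
  have \<kappa>: "\<kappa> > 0" "\<kappa> \<le> c * (\<theta> + 1)" "\<kappa> * g_primitive (v r1) \<le> p r1 powr (\<theta> + 1)"
  proof -
    have "p r1 > 0" "g_primitive (v r1) > 0" using pp[of r1] r1 g_primitive_pos[OF vt(2)] by auto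
    then show "\<kappa> > 0" using c \<theta> by (simp add: \<kappa>_def)
    show "\<kappa> \<le> c * (\<theta> + 1)" by (simp add: \<kappa>_def)
    have "\<kappa> \<le> p r1 powr (\<theta> + 1) / g_primitive (v r1)" by (simp add: \<kappa>_def)
    then show "\<kappa> * g_primitive (v r1) \<le> p r1 powr (\<theta> + 1)"
      using \<open>g_primitive (v r1) > 0\<close> by (simp add: pos_le_divide_eq)
  qed
  have energy: "\<kappa> * g_primitive (v r) \<le> p r powr (\<theta> + 1)" if r: "r \<ge> r1" for r
  proof -
    have "p r1 powr (\<theta> + 1) - \<kappa> * g_primitive (v r1) \<le> p r powr (\<theta> + 1) - \<kappa> * g_primitive (v r)"
    proof (rule DERIV_nonneg_imp_nondecreasing[OF r])
      fix x assume x: "r1 \<le> x"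
      then have x0: "x > 0" "x \<ge> 1" using r1 by auto
      have "((\<lambda>r. p r powr (\<theta> + 1)) has_real_derivative (\<theta> + 1) * p x powr \<theta> * flux' ?h x) (at x)"
        using DERIV_chain2[OF has_real_derivative_powr[OF pp[OF x0(1)], of "\<theta> + 1"] pd[OF x0(1)]] by simp
      moreover have "((\<lambda>r. \<kappa> * g_primitive (v r)) has_real_derivative \<kappa> * (g (v x) * p x)) (at x)"
        by (rule DERIV_cmult[OF DERIV_chain2[OF g_primitive_has_derivative[OF vt(2)[OF x]] vd[OF x0(1)]]])
      ultimately have d: "((\<lambda>r. p r powr (\<theta> + 1) - \<kappa> * g_primitive (v r)) has_real_derivative
          (\<theta> + 1) * p x powr \<theta> * flux' ?h x - \<kappa> * (g (v x) * p x)) (at x)"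
        by (rule DERIV_diff)
      have "\<kappa> * (g (v x) * p x) \<le> c * (\<theta> + 1) * (g (v x) * p x)"
        using \<kappa>(2) g_pos[of "v x"] pp[OF x0(1)] by (intro mult_right_mono) auto
      also have "\<dots> = (\<theta> + 1) * p x * (c * g (v x))" by simp
      also have "\<dots> \<le> (\<theta> + 1) * p x * (p x powr (\<theta> - 1) * flux' ?h x)"
        using flux'_lower_bound[OF prof(2) x0(2)] \<theta> pp[OF x0(1)]
        by (intro mult_left_mono) (auto simp: c_def p_def)
      also have "\<dots> = (\<theta> + 1) * p x powr \<theta> * flux' ?h x"
        using pp[OF x0(1)] by (simp add: powr_diff)
      finally show "\<exists>D. ((\<lambda>r. p r powr (\<theta> + 1) - \<kappa> * g_primitive (v r)) has_real_derivative D) (at x) \<and> 0 \<le> D"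
        using d by (intro exI conjI) auto
    qed
    then show ?thesis using \<kappa>(3) by simp
  qed
  define \<mu> where "\<mu> = \<kappa> powr (1 / (\<theta> + 1))"
  have \<mu>: "\<mu> > 0" using \<kappa>(1) by (simp add: \<mu>_def)
  have slope: "\<mu> \<le> g_primitive (v r) powr (- 1 / (\<theta> + 1)) * p r" if r: "r \<ge> r1" for r
  proof -
    have r0: "r > 0" using r r1 by simp
    let ?u = "g_primitive (v r)"
    have u: "?u > 0" using g_primitive_pos[OF vt(2)[OF r]] .
    have "\<mu> * ?u powr (1 / (\<theta> + 1)) = (\<kappa> * ?u) powr (1 / (\<theta> + 1))"
      unfolding \<mu>_def using \<kappa>(1) u by (simp add: powr_mult)
    also have "\<dots> \<le> (p r powr (\<theta> + 1)) powr (1 / (\<theta> + 1))"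
      using energy[OF r] \<kappa>(1) u \<theta> by (intro powr_mono2) auto
    also have "\<dots> = p r" using \<theta> pp[OF r0] by (simp add: powr_powr)
    finally have "\<mu> * ?u powr (1 / (\<theta> + 1)) \<le> p r" .
    then show ?thesis using u by (simp add: powr_minus field_simps)
  qed
  have grow: "ko_integral t0 (v r1) + \<mu> * (r - r1) \<le> ko_integral t0 (v r)" if r: "r \<ge> r1" for r
  proof -
    have "ko_integral t0 (v r1) - \<mu> * r1 \<le> ko_integral t0 (v r) - \<mu> * r"
    proof (rule DERIV_nonneg_imp_nondecreasing[OF r])
      fix x assume x: "r1 \<le> x"
      then have x0: "x > 0" using r1 by simp
      have "v x > t0 / 2" using vt(1)[OF x] t0 by simp
      then have "((\<lambda>r. ko_integral t0 (v r)) has_real_derivative g_primitive (v x) powr (- 1 / (\<theta> + 1)) * p x) (at x)"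
        using DERIV_chain2[OF ko_integral_has_derivative[OF t0] vd[OF x0]] by blast
      then have "((\<lambda>r. ko_integral t0 (v r) - \<mu> * r) has_real_derivative
          g_primitive (v x) powr (- 1 / (\<theta> + 1)) * p x - \<mu>) (at x)"
        by (intro DERIV_diff DERIV_cmult_Id)
      then show "\<exists>D. ((\<lambda>r. ko_integral t0 (v r) - \<mu> * r) has_real_derivative D) (at x) \<and> 0 \<le> D"
        using slope[OF x] by (intro exI conjI) auto
    qed
    then show ?thesis by (simp add: algebra_simps)
  qed
  define r where "r = r1 + (\<bar>B - ko_integral t0 (v r1)\<bar> + 1) / \<mu>"
  have "r \<ge> r1" using \<mu> by (simp add: r_def)
  moreover have "\<mu> * (r - r1) = \<bar>B - ko_integral t0 (v r1)\<bar> + 1" using \<mu> by (simp add: r_def)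
  ultimately have "ko_integral t0 (v r) > B" "v r \<ge> t0"
    using grow[of r] vt(1)[of r] by auto
  then show "\<exists>x\<ge>t0. ko_integral t0 x > B" by blast
qed

end

section \<open>The existence criterion and the regularity classes\<close>

theorem theorem1p2:
  fixes g :: "real \<Rightarrow> real" and q \<theta> C \<tau> t0 :: real
  assumes g_pos: "\<And>x. g x > 0"
    and g_mono: "mono g"
    and g_cont: "continuous_on UNIV g"
    and q: "q \<ge> 0" and \<theta>: "\<theta> > 0" and C: "C > 0" and \<tau>: "\<tau> \<ge> \<theta> * q + 1"
    and t0: "t0 > 0"
  shows
    "((\<forall>a. \<exists>v. convex_solution g q \<theta> C \<tau> a v) \<longleftrightarrow>
        (\<integral>\<^sup>+ t\<in>{t0..}. ennreal ((integral {0..t} g) powr (- 1 / (\<theta> + 1))) \<partial>lborel) = \<infinity>)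
     \<and> (\<forall>a v. convex_solution g q \<theta> C \<tau> a v \<longrightarrow>
          (\<tau> > \<theta> * (q + 1) \<longrightarrow>
             Ck_on 2 {0..} v \<and> deriv_on {0..} (deriv_on {0..} v) 0 = 0)
        \<and> (\<tau> = \<theta> * (q + 1) \<longrightarrow>
             Ck_on 2 {0..} v \<and>
             deriv_on {0..} (deriv_on {0..} v) 0 = C * (g a / \<tau>) powr (1 / \<theta>))
        \<and> (\<tau> < \<theta> * (q + 1) \<longrightarrow>
             Ck_on 2 {0<..} v \<and>
             (\<forall>\<delta>\<in>{1<..<\<theta> / (\<theta> * (q + 1) - \<tau>)}.
                sobolev_loc 2 \<delta> {0<..} v \<and> (\<forall>R>0. sobolev 2 \<delta> {0<..<R} v))))"
proof -
  interpret cauchy_problem q \<theta> C \<tau> g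
    using assms by (simp add: cauchy_problem_def cauchy_problem_axioms_def flux_parameters_def)
  have "(\<forall>a. \<exists>v. convex_solution g q \<theta> C \<tau> a v) \<longleftrightarrow> (\<forall>B. \<exists>x\<ge>t0. ko_integral t0 x > B)"
    using convex_solution_exists[OF t0] convex_solution_imp_unbounded[OF _ t0] by blast
  then have iff: "(\<forall>a. \<exists>v. convex_solution g q \<theta> C \<tau> a v) \<longleftrightarrow>
      (\<integral>\<^sup>+ t\<in>{t0..}. ennreal ((integral {0..t} g) powr (- 1 / (\<theta> + 1))) \<partial>lborel) = \<infinity>"
    using nn_integral_infinite_iff[OF t0] by simp
  have e: "\<tau> / \<theta> - q - 1 = (\<tau> - \<theta> * (q + 1)) / \<theta>"
    using \<theta> by (simp add: field_simps)
  have i: "Ck_on 2 {0..} v \<and> deriv_on {0..} (deriv_on {0..} v) 0 = 0"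
    if v: "convex_solution g q \<theta> C \<tau> a v" and gt: "\<tau> > \<theta> * (q + 1)" for a v
  proof -
    have "\<tau> / \<theta> - q - 1 > 0" unfolding e using gt \<theta> by simp
    then show ?thesis
      using solution_Ck_2[OF convex_solution_profile(2,3)[OF v] powr_tendsto_0] by simp
  qed
  have ii: "Ck_on 2 {0..} v \<and> deriv_on {0..} (deriv_on {0..} v) 0 = C * (g a / \<tau>) powr (1 / \<theta>)"
    if v: "convex_solution g q \<theta> C \<tau> a v" and eq: "\<tau> = \<theta> * (q + 1)" for a v
  proof -
    have e0: "\<tau> / \<theta> - q - 1 = 0" unfolding e using eq by simp
    have "((\<lambda>r. r powr (\<tau> / \<theta> - q - 1)) \<longlongrightarrow> 1) (at_right 0)"
      unfolding e0 by (rule Lim_transform_eventually[OF tendsto_const]) (auto simp: eventually_at_filter)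
    moreover have "1 * (\<tau> / \<theta> - q) = 1" using e0 by simp
    ultimately show ?thesis
      using solution_Ck_2[OF convex_solution_profile(2,3)[OF v]] convex_solution_profile(1)[OF v] by simp
  qed
  have iii: "Ck_on 2 {0<..} v \<and> (\<forall>\<delta>\<in>{1<..<\<theta> / (\<theta> * (q + 1) - \<tau>)}.
      sobolev_loc 2 \<delta> {0<..} v \<and> (\<forall>R>0. sobolev 2 \<delta> {0<..<R} v))"
    if v: "convex_solution g q \<theta> C \<tau> a v" and lt: "\<tau> < \<theta> * (q + 1)" for a v
  proof (intro conjI ballI)
    note sol = convex_solution_profile(2,3)[OF v]
    show "Ck_on 2 {0<..} v" by (rule solution_Ck_2_interior[OF sol])
    fix \<delta> assume \<delta>: "\<delta> \<in> {1<..<\<theta> / (\<theta> * (q + 1) - \<tau>)}"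
    have d0: "\<delta> > 0" using \<delta> by simp
    have "\<delta> * (\<theta> * (q + 1) - \<tau>) < \<theta>"
      using \<delta> lt by (simp add: pos_less_divide_eq)
    then have "(\<tau> - \<theta> * (q + 1)) * \<delta> > - \<theta>" by (simp add: algebra_simps)
    then have d1: "(\<tau> / \<theta> - q - 1) * \<delta> > - 1"
      unfolding e using \<theta> by (simp add: pos_less_divide_eq)
    show "sobolev_loc 2 \<delta> {0<..} v" by (rule solution_sobolev_loc[OF sol d0 d1])
    show "\<forall>R>0. sobolev 2 \<delta> {0<..<R} v"
      by (intro allI impI solution_sobolev[OF sol _ _ _ d0 d1]) auto
  qed
  show ?thesis
    by (rule conjI[OF iff]) (intro allI impI conjI[OF impI conjI[OF impI impI]] i ii iii)
qed

end
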